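(* Let $\Omega\subset\mathbb{C}^n$ be a bounded domain which is starlike (i.e. there is $\omega_0\in\Omega$ such that the segment $\{t\omega_0+(1-t)\omega:0\le t\le1\}$ lies in $\Omega$ for every $\omega\in\Omega$). Let $\mathcal R$ and $\mathcal R'$ be quasi-free Hilbert modules of finite rank $m$ over $A(\Omega)$ with generating sets $\{f_1,\dots,f_m\}$ and $\{g_1,\dots,g_m\}$. If the modulus $\mu(\mathcal R,\mathcal R')$ is the absolute value of a function $\Psi\in\mathrm{Hol}_m(\Omega)$ (i.e. $\mu(\mathcal R,\mathcal R')(z)^2=\Psi(z)^*\Psi(z)$ for all $z\in\Omega$), then $\mathcal R$ and $\mathcal R'$ are unitarily equivalent.
   Context: $A(\Omega)$ is the closure, in the supremum norm on $\Omega$, of the set of functions holomorphic on some neighbourhood of $\overline\Omega$. $\ell^2_m$ denotes the $m$-dimensional Hilbert space, and $\mathrm{Hol}_m(\Omega)$ the space of holomorphic functions $\Omega\to\mathcal L(\ell^2_m)$. A quasi-free Hilbert module of rank $m$ over $A(\Omega)$ is a Hilbert space $\mathcal R$ obtained as the completion of $A(\Omega)\otimes\ell^2_m$ (regarded as $\ell^2_m$-valued holomorphic functions on $\Omega$) with respect to an inner product such that: (1) for each $z\in\Omega$ the evaluation map $\mathrm{eval}_z:A(\Omega)\otimes\ell^2_m\to\ell^2_m$ is bounded, with norm locally uniformly bounded in $z$; (2) $\|\varphi F\|_{\mathcal R}\le\|\varphi\|_{A(\Omega)}\|F\|_{\mathcal R}$; (3) if $(F_i)$ is Cauchy in the $\mathcal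 R$-norm, then $\mathrm{eval}_z(F_i)\to0$ for all $z$ iff $\|F_i\|_{\mathcal R}\to0$. Elements of $\mathcal R$ are $\ell^2_m$-valued holomorphic functions and $A(\Omega)$ acts by multiplication. For $z\in\Omega$, $\mathbb C_z$ is $\mathbb C$ with action $\varphi\cdot\lambda=\varphi(z)\lambda$; the localization $\mathcal R\otimes_{A(\Omega)}\mathbb C_z$ is identified with $\mathcal R/\mathcal R_z$, $\mathcal R_z$ the closure of $A(\Omega)_z\mathcal R$, $A(\Omega)_z=\{\varphi:\varphi(z)=0\}$; $h\otimes1_z$ is the class of $h$. A generating set of $\mathcal R$ is $\{f_1,\dots,f_m\}\subset\mathcal R$ whose $A(\Omega)$-multiples span a dense subspace and with $\{f_i\otimes1_z\}$ a basis of $\mathcal R\otimes_{A(\Omega)}\mathbb C_z$ for all $z$. The closure in $\mathcal R\oplus\mathcal R'$ of the span of $\{\varphi f_i\oplus\varphi g_i\}$ is the graph of a closed, densely defined, injective module transformation $\delta=\delta(\mathcal R,\mathcal R')$ with dense range, inducing for each $z$ an invertible linear map $\delta\otimes1_z:\mathcal R\otimes_{A(\Omega)}\mathbb C_z\to\mathcal R'\otimes_{A(\Omega)}\mathbb C_z$, $h\otimes1_z\mapsto\delta h\otimes1_z$. The modulus is $\mu(\mathcal R,\mathcal R')(z)=((\delta\otimes1_z)^*(\delta\otimes1_z))^{1/2}$, regarded as an $m\times m$ matrix. Unitary equivalence means existence of a unitary $U:\mathcal R\to\mathcal R'$ commuting with the action of $A(\Omega)$. *)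

theory Defs
  imports "HOL-Analysis.Analysis"
begin

definition holo_on :: "(complex^'n) set \<Rightarrow> (complex^'n \<Rightarrow> complex) \<Rightarrow> bool" where
  "holo_on U h \<longleftrightarrow> (\<forall>z\<in>U. \<exists>D. (h has_derivative D) (at z) \<and>
                        (\<forall>c v. D (c *s v) = c * D v))"

definition holo_vec :: "(complex^'n) set \<Rightarrow> (complex^'n \<Rightarrow> complex^'m) \<Rightarrow> bool" where
  "holo_vec U F \<longleftrightarrow> (\<forall>i. holo_on U (\<lambda>z. F z $ i))"

definition holo_mat :: "(complex^'n) set \<Rightarrow> (complex^'n \<Rightarrow> complex^'m^'m) \<Rightarrow> bool" where
  "holo_mat U P \<longleftrightarrow> (\<forall>i j. holo_on U (\<lambda>z. P z $ i $ j))"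

definition A_alg :: "(complex^'n) set \<Rightarrow> (complex^'n \<Rightarrow> complex) set" where
  "A_alg S = {\<phi>. \<forall>\<epsilon>>0. \<exists>U g. open U \<and> closure S \<subseteq> U \<and> holo_on U g \<and>
                  (\<forall>z\<in>S. cmod (\<phi> z - g z) < \<epsilon>)}"

definition supnorm :: "(complex^'n) set \<Rightarrow> (complex^'n \<Rightarrow> complex) \<Rightarrow> real" where
  "supnorm S \<phi> = (SUP z\<in>S. cmod (\<phi> z))"

text \<open>Elements of a module are l2_m-valued functions on Omega (extended by 0 outside Omega).\<close>

definition cspan :: "('a \<Rightarrow> complex^'m::finite) set \<Rightarrow> ('a \<Rightarrow> complex^'m) set" where
  "cspan X = {F. \<exists>(k::nat) (c::nat \<Rightarrow> complex) h. (\<forall>i<k. h i \<in> X) \<and> F = (\<lambda>w. \<Sum>i<k. c i *s h i w)}"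

definition alg_tensor :: "(complex^'n::finite) set \<Rightarrow> (complex^'n \<Rightarrow> complex^'m::finite) set" where
  "alg_tensor S = cspan {F. \<exists>\<phi> v. \<phi> \<in> A_alg S \<and> F = (\<lambda>z. if z \<in> S then \<phi> z *s v else 0)}"

definition rnorm :: "(('a \<Rightarrow> complex^'m) \<Rightarrow> ('a \<Rightarrow> complex^'m) \<Rightarrow> complex)
                      \<Rightarrow> ('a \<Rightarrow> complex^'m) \<Rightarrow> real" where
  "rnorm ip F = sqrt (Re (ip F F))"

definition rcauchy where
  "rcauchy ip X \<longleftrightarrow> (\<forall>\<epsilon>>0. \<exists>N. \<forall>k\<ge>N. \<forall>l\<ge>N. rnorm ip (\<lambda>w. X k w - X l w) < \<epsilon>)"

definition quasi_free ::
  "(complex^'n) set \<Rightarrow> (complex^'n \<Rightarrow> complex^'m) set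
     \<Rightarrow> ((complex^'n \<Rightarrow> complex^'m) \<Rightarrow> (complex^'n \<Rightarrow> complex^'m) \<Rightarrow> complex) \<Rightarrow> bool" where
  "quasi_free S R ip \<longleftrightarrow>
     \<comment> \<open>functions on Omega, extended by zero; they are holomorphic on Omega\<close>
     (\<forall>F\<in>R. (\<forall>z. z \<notin> S \<longrightarrow> F z = 0) \<and> holo_vec S F) \<and>
     \<comment> \<open>complex vector space\<close>
     (\<lambda>z. 0) \<in> R \<and>
     (\<forall>F\<in>R. \<forall>G\<in>R. (\<lambda>z. F z + G z) \<in> R) \<and>
     (\<forall>F\<in>R. \<forall>c. (\<lambda>z. c *s F z) \<in> R) \<and>
     \<comment> \<open>inner product (linear in the first, conjugate-linear in the second argument)\<close>
     (\<forall>F\<in>R. \<forall>G\<in>R. \<forall>H\<in>R. ip (\<lambda>z. F z + G z) H = ip F H + ip G H) \<and>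
     (\<forall>F\<in>R. \<forall>H\<in>R. \<forall>c. ip (\<lambda>z. c *s F z) H = c * ip F H) \<and>
     (\<forall>F\<in>R. \<forall>H\<in>R. ip H F = cnj (ip F H)) \<and>
     (\<forall>F\<in>R. Re (ip F F) \<ge> 0) \<and>
     (\<forall>F\<in>R. ip F F = 0 \<longrightarrow> F = (\<lambda>z. 0)) \<and>
     \<comment> \<open>completeness (Hilbert space)\<close>
     (\<forall>X. (\<forall>k. X k \<in> R) \<and> rcauchy ip X \<longrightarrow>
          (\<exists>F\<in>R. (\<lambda>k. rnorm ip (\<lambda>w. X k w - F w)) \<longlonglongrightarrow> 0)) \<and>
     \<comment> \<open>R is the completion of A(Omega) (x) l2_m\<close>
     alg_tensor S \<subseteq> R \<and>
     (\<forall>F\<in>R. \<forall>\<epsilon>>0. \<exists>H\<in>alg_tensor S. rnorm ip (\<lambda>w. F w - H w) < \<epsilon>) \<and>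
     \<comment> \<open>(1) bounded evaluations, locally uniformly bounded norms\<close>
     (\<forall>z\<in>S. \<exists>r>0. \<exists>C. \<forall>w\<in>S \<inter> ball z r. \<forall>F\<in>alg_tensor S. norm (F w) \<le> C * rnorm ip F) \<and>
     \<comment> \<open>(2) contractive module action by multiplication\<close>
     (\<forall>\<phi>\<in>A_alg S. \<forall>F\<in>R. (\<lambda>z. \<phi> z *s F z) \<in> R \<and>
          rnorm ip (\<lambda>z. \<phi> z *s F z) \<le> supnorm S \<phi> * rnorm ip F) \<and>
     \<comment> \<open>(3)\<close>
     (\<forall>X. (\<forall>k. X k \<in> alg_tensor S) \<and> rcauchy ip X \<longrightarrow>
          ((\<forall>z\<in>S. (\<lambda>k. X k z) \<longlonglongrightarrow> 0) \<longleftrightarrow> (\<lambda>k. rnorm ip (X k)) \<longlonglongrightarrow> 0))"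

definition rclosure where
  "rclosure R ip X = {F\<in>R. \<forall>\<epsilon>>0. \<exists>H\<in>X. rnorm ip (\<lambda>w. F w - H w) < \<epsilon>}"

definition Rsub where
  "Rsub S R ip z = rclosure R ip
     (cspan {G. \<exists>\<phi> F. \<phi> \<in> A_alg S \<and> \<phi> z = 0 \<and> F \<in> R \<and> G = (\<lambda>w. \<phi> w *s F w)})"

definition comb :: "('m::finite \<Rightarrow> 'a \<Rightarrow> complex^'k) \<Rightarrow> complex^'m \<Rightarrow> 'a \<Rightarrow> complex^'k" where
  "comb f c = (\<lambda>w. \<Sum>i\<in>UNIV. (c $ i) *s f i w)"

definition gen_set where
  "gen_set S R ip f \<longleftrightarrow>
     (\<forall>i. f i \<in> R) \<and>
     (\<forall>F\<in>R. \<forall>\<epsilon>>0. \<exists>H\<in>cspan {G. \<exists>\<phi> i. \<phi> \<in> A_alg S \<and> G = (\<lambda>w. \<phi> w *s f i w)}.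
                     rnorm ip (\<lambda>w. F w - H w) < \<epsilon>) \<and>
     (\<forall>z\<in>S. (\<forall>F\<in>R. \<exists>c. (\<lambda>w. F w - comb f c w) \<in> Rsub S R ip z) \<and>
             (\<forall>c. comb f c \<in> Rsub S R ip z \<longrightarrow> c = 0))"

text \<open>Localization R (x) C_z = R / R_z with its quotient Hilbert space structure, realised
  through the orthogonal complement of R_z: the class of F is represented by its component
  orthogonal to R_z.\<close>
definition orth_part where
  "orth_part S R ip z F = (THE h. h \<in> R \<and> (\<lambda>w. F w - h w) \<in> Rsub S R ip z \<and>
                                  (\<forall>k\<in>Rsub S R ip z. ip h k = 0))"

definition loc_ip where
  "loc_ip S R ip z F H = ip (orth_part S R ip z F) (orth_part S R ip z H)"

text \<open>Square of the modulus, (delta (x) 1_z)^* (delta (x) 1_z), as an m x m matrix w.r.t. the basis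
  f_i (x) 1_z of R (x) C_z.  Here delta (x) 1_z maps f_i (x) 1_z to g_i (x) 1_z.\<close>
definition modulus_sq where
  "modulus_sq S R ip R' ip' f g z = (THE M :: complex^'m^'m.
      \<forall>c d. loc_ip S R' ip' z (comb g c) (comb g d) = loc_ip S R ip z (comb f (M *v c)) (comb f d))"

text \<open>Psi(z)^* Psi(z), where Psi(z) acts on R (x) C_z through the basis f_i (x) 1_z and the
  adjoint is taken in R (x) C_z; again as matrix w.r.t. that basis.\<close>
definition abs_sq where
  "abs_sq S R ip f P z = (THE N :: complex^'m^'m.
      \<forall>c d. loc_ip S R ip z (comb f (P z *v c)) (comb f (P z *v d)) =
            loc_ip S R ip z (comb f (N *v c)) (comb f d))"

definition unit_equiv where
  "unit_equiv S R ip R' ip' \<longleftrightarrow> (\<exists>U. bij_betw U R R' \<and>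
      (\<forall>F\<in>R. \<forall>G\<in>R. U (\<lambda>w. F w + G w) = (\<lambda>w. U F w + U G w)) \<and>
      (\<forall>F\<in>R. \<forall>c. U (\<lambda>w. c *s F w) = (\<lambda>w. c *s U F w)) \<and>
      (\<forall>F\<in>R. \<forall>G\<in>R. ip' (U F) (U G) = ip F G) \<and>
      (\<forall>\<phi>\<in>A_alg S. \<forall>F\<in>R. U (\<lambda>w. \<phi> w *s F w) = (\<lambda>w. \<phi> w *s U F w)))"

end

theory Submission
  imports Defs "HOL-Complex_Analysis.Conformal_Mappings" "HOL-Library.Function_Algebras"
begin

text \<open>
  Coordinates with respect to the generators \<open>f i \<otimes> 1\<^sub>z\<close> turn the localizations of \<open>R\<close> at the points
  of \<open>S\<close> into holomorphic evaluation maps \<open>C z : R \<rightarrow> \<complex>\<^sup>m\<close> with kernels \<open>R\<^sub>z\<close>, and thus exhibit \<open>R\<close> as a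
  space with reproducing kernel \<open>K z w = C z (C w)\<^sup>*\<close>; likewise one gets \<open>K'\<close> for \<open>R'\<close>.  In these coordinates
  the inner products of the two localizations at \<open>z\<close> are given by \<open>(K z z)\<^sup>-\<^sup>1\<close> and \<open>(K' z z)\<^sup>-\<^sup>1\<close>, so the
  hypothesis on the modulus says \<open>(K' z z)\<^sup>-\<^sup>1 = \<Psi>(z)\<^sup>* (K z z)\<^sup>-\<^sup>1 \<Psi>(z)\<close>.  Hence \<open>\<Psi>(z)\<close> is invertible and
  \<open>K z z = \<Psi>(z) K' z z \<Psi>(z)\<^sup>*\<close>.  Both sides are restrictions to the diagonal of kernels that are holomorphic
  in the first and antiholomorphic in the second variable, so \<open>K z w = \<Psi>(z) K' z w \<Psi>(w)\<^sup>*\<close> for all \<open>z\<close>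
  and \<open>w\<close>.  Mapping the kernel functions of \<open>K\<close> to those of \<open>K'\<close> composed with \<open>\<Psi>(w)\<^sup>*\<close> is therefore
  isometric with dense range, and it extends to the required unitary, which satisfies
  \<open>\<Psi>(z) (C' z (U F)) = C z F\<close> and so commutes with multiplication by functions.
\<close>

text \<open>Bounds on evaluation are given only on \<open>alg_tensor S\<close>, so the coordinate
  maps are built from limits of evaluations along approximants rather than from the values
  \<open>F z\<close>; condition (3) then lets these limits distinguish the elements of
  \<open>R\<close>. Polarization rests on a choice of curve: for fixed p and q the pair (p + t q, p
  + cnj t q) lies on the diagonal for real t, and the difference of the kernels at this pair is
  holomorphic in t. Every pair near the centre of the star is reached at t = \<i>, and from there
  the two variables are continued one at a time along the star. Finally \<Psi> is absorbed into the
  evaluation: \<open>R'\<close> with the maps \<Psi>(z) C' z is again a reproducing kernel space,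
  and what remains is the uniqueness of a Hilbert space with given kernel.\<close>

section \<open>Holomorphy along complex lines\<close>

text \<open>Holomorphy in the sense of Osgood: continuity together with holomorphy on every complex line.
  Only this much is needed, and it is stable under locally uniform limits.\<close>

definition lhol :: "(complex^'n) set \<Rightarrow> (complex^'n \<Rightarrow> complex) \<Rightarrow> bool" where
  "lhol S h \<longleftrightarrow> continuous_on S h \<and> (\<forall>p q. (\<lambda>t. h (p + t *s q)) holomorphic_on {t. p + t *s q \<in> S})"

lemma bounded_linear_line: "bounded_linear (\<lambda>t::complex. t *s (q::complex^'n::finite))"
proof (rule bounded_linear_componentwise_iff[THEN iffD2], rule ballI)
  fix b :: "complex^'n" assume b: "b \<in> Basis"
  show "bounded_linear (\<lambda>t. (t *s q) \<bullet> b)"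
    unfolding inner_vec_def
    by (intro bounded_linear_sum) (auto intro!: bounded_linear_compose[OF bounded_linear_inner_left] bounded_linear_mult_left)
qed

lemma continuous_on_line [continuous_intros]:
  fixes p q :: "complex^'n::finite"
  assumes "continuous_on A f"
  shows "continuous_on A (\<lambda>x. p + f x *s q)"
  using bounded_linear.continuous_on[OF bounded_linear_line assms] by (intro continuous_intros)

lemma open_line:
  fixes p q :: "complex^'n::finite"
  assumes "open S" shows "open {t. p + t *s q \<in> S}"
  using open_vimage[OF assms, of "\<lambda>t. p + t *s q"] by (simp add: vimage_def continuous_on_line continuous_on_id)

lemma lhol_const: "lhol S (\<lambda>z. c)"
  by (simp add: lhol_def)

lemma lhol_add: "lhol S f \<Longrightarrow> lhol S g \<Longrightarrow> lhol S (\<lambda>z. f z + g z)"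
  by (auto simp: lhol_def intro!: continuous_intros holomorphic_intros)

lemma lhol_diff: "lhol S f \<Longrightarrow> lhol S g \<Longrightarrow> lhol S (\<lambda>z. f z - g z)"
  by (auto simp: lhol_def intro!: continuous_intros holomorphic_intros)

lemma lhol_mult: "lhol S f \<Longrightarrow> lhol S g \<Longrightarrow> lhol S (\<lambda>z. f z * g z)"
  by (auto simp: lhol_def intro!: continuous_intros holomorphic_intros)

lemma lhol_divide:
  assumes "lhol S f" "lhol S g" "\<And>z. z \<in> S \<Longrightarrow> g z \<noteq> 0"
  shows "lhol S (\<lambda>z. f z / g z)"
  using assms by (auto simp: lhol_def intro!: continuous_intros holomorphic_intros)

lemma lhol_sum: "(\<And>i. i \<in> I \<Longrightarrow> lhol S (f i)) \<Longrightarrow> lhol S (\<lambda>z. \<Sum>i\<in>I. f i z)"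
  by (induction I rule: infinite_finite_induct) (auto intro: lhol_add lhol_const)

lemma lhol_prod: "(\<And>i. i \<in> I \<Longrightarrow> lhol S (f i)) \<Longrightarrow> lhol S (\<lambda>z. \<Prod>i\<in>I. f i z)"
  by (induction I rule: infinite_finite_induct) (auto intro: lhol_mult lhol_const)

lemma lhol_det:
  fixes A :: "complex^'n \<Rightarrow> complex^'m::finite^'m"
  assumes "\<And>i j. lhol S (\<lambda>z. A z $ i $ j)"
  shows "lhol S (\<lambda>z. det (A z))"
  unfolding det_def by (intro lhol_sum lhol_mult lhol_const lhol_prod assms)

lemma lhol_cong: "(\<And>z. z \<in> S \<Longrightarrow> f z = g z) \<Longrightarrow> lhol S f \<longleftrightarrow> lhol S g"
  unfolding lhol_def by (intro conj_cong continuous_on_cong all_cong1 holomorphic_cong) auto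

text \<open>Cramer's rule turns each coordinate of the solution into a quotient of determinants,
  which are polynomials in the entries of \<open>A\<close> and \<open>b\<close>. This gives
  holomorphy of inverse matrices and of coordinates in a moving basis.\<close>

lemma lhol_solve:
  fixes A :: "complex^'n \<Rightarrow> complex^'m::finite^'m"
  assumes "\<And>i j. lhol S (\<lambda>z. A z $ i $ j)" "\<And>i. lhol S (\<lambda>z. b z $ i)"
    and "\<And>z. z \<in> S \<Longrightarrow> invertible (A z)" "\<And>z. z \<in> S \<Longrightarrow> A z *v x z = b z"
  shows "lhol S (\<lambda>z. x z $ k)"
proof -
  have nz: "det (A z) \<noteq> 0" if "z \<in> S" for z
    using assms(3)[OF that] by (simp add: invertible_det_nz)
  have "x z $ k = det (\<chi> i j. if j = k then b z $ i else A z $ i $ j) / det (A z)" if "z \<in> S" for z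
    using cramer[OF nz[OF that], of "x z" "b z"] assms(4)[OF that] by simp
  moreover have "lhol S (\<lambda>z. (\<chi> i j. if j = k then b z $ i else A z $ i $ j) $ i' $ j')" for i' j'
    using assms(1,2) by (cases "j' = k") simp_all
  ultimately show ?thesis
    by (subst lhol_cong) (auto intro!: lhol_divide lhol_det assms nz)
qed

text \<open>By the chain rule the derivative along a line sends x to D (x q), and complex
  homogeneity of \<open>D\<close> makes this multiplication by D q.\<close>

lemma holo_on_imp_lhol:
  fixes h :: "complex^'n::finite \<Rightarrow> complex"
  assumes "holo_on S h" shows "lhol S h"
  unfolding lhol_def
proof (intro conjI allI)
  show "continuous_on S h"
    using assms has_derivative_continuous unfolding holo_on_def
    by (blast intro: continuous_at_imp_continuous_on)
  fix p q :: "complex^'n"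
  have "(\<lambda>t. h (p + t *s q)) field_differentiable (at t)" if t: "p + t *s q \<in> S" for t
  proof -
    obtain D where D: "(h has_derivative D) (at (p + t *s q))" "\<And>c v. D (c *s v) = c * D v"
      using bspec[OF assms[unfolded holo_on_def] t] by auto
    have "((\<lambda>t. p + t *s q) has_derivative (\<lambda>x. x *s q)) (at t)"
      using has_derivative_add[OF has_derivative_const[of p] bounded_linear_imp_has_derivative[OF bounded_linear_line]]
      by simp
    from diff_chain_at[OF this D(1)]
    have "((\<lambda>t. h (p + t *s q)) has_derivative (\<lambda>x. D q * x)) (at t)"
      by (simp add: o_def D(2) mult.commute)
    then show ?thesis
      unfolding field_differentiable_def has_field_derivative_def by blast
  qed
  then show "(\<lambda>t. h (p + t *s q)) holomorphic_on {t. p + t *s q \<in> S}"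
    by (auto simp: holomorphic_on_def intro: field_differentiable_at_within)
qed

text \<open>Continuity passes to the limit by the uniform limit theorem, and holomorphy on a line by
  Weierstrass's theorem on a closed disc that the line maps into a region of uniform
  convergence.\<close>

lemma lhol_uniform_limit:
  fixes f :: "nat \<Rightarrow> complex^'n::finite \<Rightarrow> complex"
  assumes S: "open S" and f: "\<And>k. lhol S (f k)"
    and lim: "\<And>z. z \<in> S \<Longrightarrow> \<exists>r>0. uniform_limit (S \<inter> ball z r) f h sequentially"
  shows "lhol S h"
  unfolding lhol_def
proof (intro conjI allI)
  have "isCont h z" if z: "z \<in> S" for z
  proof -
    obtain r where r: "r > 0" and u: "uniform_limit (S \<inter> ball z r) f h sequentially"
      using lim[OF z] by blast
    have "continuous_on (S \<inter> ball z r) h"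
      using f by (intro uniform_limit_theorem[OF _ u]) (auto simp: lhol_def intro!: always_eventually intro: continuous_on_subset)
    then show ?thesis using S z r by (simp add: continuous_on_eq_continuous_at open_Int)
  qed
  then show "continuous_on S h" by (simp add: continuous_at_imp_continuous_on)
  fix p q :: "complex^'n"
  have "(\<lambda>t. h (p + t *s q)) field_differentiable (at t)" if t: "p + t *s q \<in> S" for t
  proof -
    obtain r where r: "r > 0" and u: "uniform_limit (S \<inter> ball (p + t *s q) r) f h sequentially"
      using lim[OF t] by blast
    let ?W = "{x. p + x *s q \<in> S \<inter> ball (p + t *s q) r}"
    have "open ?W" using S by (intro open_line) auto
    then obtain e where e: "e > 0" "cball t e \<subseteq> ?W"
      using t r unfolding open_contains_cball by auto
    have "uniform_limit (cball t e) (\<lambda>k x. f k (p + x *s q)) (\<lambda>x. h (p + x *s q)) sequentially"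
      using u e(2) unfolding uniform_limit_iff by (fastforce elim!: eventually_mono)
    moreover have "continuous_on (cball t e) (\<lambda>x. f k (p + x *s q)) \<and>
       (\<lambda>x. f k (p + x *s q)) holomorphic_on ball t e" for k
    proof -
      have "(\<lambda>x. f k (p + x *s q)) holomorphic_on cball t e"
        using f[of k] e(2) by (auto simp: lhol_def intro: holomorphic_on_subset)
      then show ?thesis
        by (meson ball_subset_cball holomorphic_on_imp_continuous_on holomorphic_on_subset)
    qed
    ultimately have "(\<lambda>x. h (p + x *s q)) holomorphic_on ball t e"
      using holomorphic_uniform_limit[of t e "\<lambda>k x. f k (p + x *s q)" sequentially
          "\<lambda>x. h (p + x *s q)"] by simp
    then show ?thesis
      using e(1) by (meson centre_in_ball holomorphic_on_imp_differentiable_at open_ball)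
  qed
  then show "(\<lambda>t. h (p + t *s q)) holomorphic_on {t. p + t *s q \<in> S}"
    by (auto simp: holomorphic_on_def intro: field_differentiable_at_within)
qed

section \<open>Sesqui-holomorphic functions and the diagonal\<close>

text \<open>This is the Schwarz lemma for the difference from the value at the centre, rescaled to
  the unit disc.\<close>

lemma holomorphic_bounded_lipschitz:
  assumes f: "f holomorphic_on ball z r" and B: "\<And>w. w \<in> ball z r \<Longrightarrow> cmod (f w) \<le> B"
    and w: "w \<in> ball z r"
  shows "cmod (f w - f z) \<le> 3 * B / r * cmod (w - z)"
proof -
  have r: "r > 0" using w by (metis ball_eq_empty empty_iff not_le)
  have z: "z \<in> ball z r" using r by simp
  have d: "cmod (f u - f z) \<le> 2 * B" if "u \<in> ball z r" for u
    using B[OF that] B[OF z] norm_triangle_ineq4[of "f u" "f z"] by linarith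
  show ?thesis
  proof (cases "B = 0")
    case True
    then show ?thesis using d[OF w] by simp
  next
    case False
    then have B0: "B > 0" using B[OF z] norm_ge_zero[of "f z"] by linarith
    \<comment> \<open>The difference is at most 2 B; dividing by 3 B yields the strict bound by 1
      that the Schwarz lemma asks for.\<close>
    define g where "g x = (f (z + of_real r * x) - f z) / of_real (3 * B)" for x
    have im: "z + of_real r * x \<in> ball z r" if "cmod x < 1" for x
      using that r by (simp add: dist_norm norm_mult)
    have "(\<lambda>x. f (z + of_real r * x)) holomorphic_on ball 0 1"
    proof (rule holomorphic_on_compose_gen[OF _ f, unfolded o_def])
      show "(\<lambda>x. z + of_real r * x) holomorphic_on ball 0 1" by (intro holomorphic_intros)
      show "(\<lambda>x. z + of_real r * x) ` ball 0 1 \<subseteq> ball z r" using im by auto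
    qed
    then have hol: "g holomorphic_on ball 0 1"
      unfolding g_def using B0 by (intro holomorphic_intros) auto
    have "cmod (g x) < 1" if "cmod x < 1" for x
    proof -
      have "cmod (g x) = cmod (f (z + of_real r * x) - f z) / (3 * B)"
        using B0 by (simp add: g_def norm_divide norm_mult)
      moreover have "cmod (f (z + of_real r * x) - f z) < 3 * B"
        using d[OF im[OF that]] B0 by linarith
      ultimately show ?thesis using B0 by simp
    qed
    moreover have "cmod ((w - z) / of_real r) < 1"
      using w r by (simp add: norm_divide dist_norm norm_minus_commute divide_simps)
    ultimately have "cmod (g ((w - z) / of_real r)) \<le> cmod ((w - z) / of_real r)"
      using hol by (intro Schwarz_Lemma(1)) (auto simp: g_def[of 0])
    then have "cmod (f w - f z) / (3 * B) \<le> cmod (w - z) / r"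
      using r B0 by (simp add: g_def norm_divide norm_mult)
    then show ?thesis using B0 r by (simp add: field_simps)
  qed
qed

text \<open>The diagonal differs from a sum of one-variable functions by a mixed second difference,
  and this is quadratically small by two applications of the Lipschitz bound.\<close>

lemma separately_holomorphic_diagonal:
  fixes k :: "complex \<Rightarrow> complex \<Rightarrow> complex"
  assumes r: "r > 0"
    and k1: "\<And>y. y \<in> ball a r \<Longrightarrow> (\<lambda>x. k x y) holomorphic_on ball a r"
    and k2: "\<And>x. x \<in> ball a r \<Longrightarrow> (\<lambda>y. k x y) holomorphic_on ball a r"
    and B: "\<And>x y. x \<in> ball a r \<Longrightarrow> y \<in> ball a r \<Longrightarrow> cmod (k x y) \<le> B"
  shows "(\<lambda>t. k t t) field_differentiable (at a)"
proof -
  define E where "E t = k t t - k t a - k a t + k a a" for t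
  have a: "a \<in> ball a r" using r by simp
  have E: "cmod (E t) \<le> (3 * (3 * B / r) / r * cmod (t - a)) * cmod (t - a)" if t: "t \<in> ball a r" for t
  proof -
    \<comment> \<open>The Lipschitz bound in the second variable serves as the sup bound when the
      lemma is applied in the first, whence the nested constant.\<close>
    have "cmod ((k t t - k t a) - (k a t - k a a)) \<le> 3 * (3 * B / r * cmod (t - a)) / r * cmod (t - a)"
    proof (rule holomorphic_bounded_lipschitz[of "\<lambda>x. k x t - k x a", OF _ _ t])
      show "(\<lambda>x. k x t - k x a) holomorphic_on ball a r"
        using k1 t a by (intro holomorphic_intros)
      show "cmod (k x t - k x a) \<le> 3 * B / r * cmod (t - a)" if "x \<in> ball a r" for x
        using holomorphic_bounded_lipschitz[OF k2 B, OF that that _ t] by simp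
    qed
    then show ?thesis by (simp add: E_def algebra_simps)
  qed
  have "((\<lambda>t. (E t - E a) / (t - a)) \<longlongrightarrow> 0) (at a)"
  proof (rule Lim_null_comparison)
    show "\<forall>\<^sub>F t in at a. norm ((E t - E a) / (t - a)) \<le> 3 * (3 * B / r) / r * cmod (t - a)"
      unfolding eventually_at using r E
      by (intro exI[of _ r]) (auto simp: norm_divide E_def[of a] dist_commute pos_divide_le_eq)
    have "((\<lambda>t. 3 * (3 * B / r) / r * cmod (t - a)) \<longlongrightarrow> 3 * (3 * B / r) / r * cmod (a - a)) (at a)"
      by (intro tendsto_intros)
    then show "((\<lambda>t. 3 * (3 * B / r) / r * cmod (t - a)) \<longlongrightarrow> 0) (at a)" by simp
  qed
  then have "E field_differentiable (at a)"
    unfolding field_differentiable_def has_field_derivative_iff by blast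
  moreover have "(\<lambda>x. k x a) field_differentiable (at a)" "(\<lambda>y. k a y) field_differentiable (at a)"
    using k1[OF a] k2[OF a] a by (meson holomorphic_on_imp_differentiable_at open_ball)+
  ultimately have "(\<lambda>t. k t a + k a t - k a a + E t) field_differentiable (at a)"
    by (intro derivative_intros)
  then show ?thesis by (simp add: E_def)
qed

lemma holomorphic_zero_on_open:
  fixes a :: complex
  assumes "f holomorphic_on T" "open T" "connected T" "a \<in> T" "open W" "a \<in> W" "\<And>t. t \<in> W \<Longrightarrow> f t = 0"
    and "b \<in> T"
  shows "f b = 0"
proof (rule analytic_continuation[of f T "T \<inter> W" a b])
  show "a islimpt T \<inter> W" using assms by (intro interior_limit_point) (simp add: interior_open open_Int)
qed (use assms in auto)

text \<open>The complex line through \<open>a\<close> and \<open>z\<close> reduces this to the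
  identity theorem in one variable.\<close>

lemma lhol_zero_on_starlike:
  fixes S :: "(complex^'n::finite) set"
  assumes f: "lhol S f" and S: "open S" and st: "\<And>z. z \<in> S \<Longrightarrow> closed_segment a z \<subseteq> S"
    and W: "open W" "a \<in> W" "\<And>z. z \<in> W \<Longrightarrow> f z = 0" and z: "z \<in> S"
  shows "f z = 0"
proof -
  let ?g = "\<lambda>t. f (a + t *s (z - a))"
  let ?T = "{t. a + t *s (z - a) \<in> S}"
  \<comment> \<open>The slice of \<open>S\<close> by the line may be disconnected, so the argument
    runs on the component of 0; it contains 1 because the parameters in [0, 1] trace the segment
    from \<open>a\<close> to \<open>z\<close>.\<close>
  let ?C = "connected_component_set ?T 0"
  have seg: "a + of_real x *s (z - a) \<in> S" if "x \<in> {0..1}" for x :: real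
  proof -
    have "a + of_real x *s (z - a) = (1 - x) *\<^sub>R a + x *\<^sub>R z"
      by (simp add: vec_eq_iff) (simp add: scaleR_conv_of_real algebra_simps)
    then show ?thesis using st[OF z] that by (auto simp: closed_segment_def)
  qed
  have T: "open ?T" using S by (rule open_line)
  have aS: "a \<in> S" using seg[of 0] by simp
  have "connected (complex_of_real ` {0..1})"
    by (intro connected_continuous_image continuous_intros) auto
  then have "complex_of_real ` {0..1} \<subseteq> ?C"
    using seg by (intro connected_component_maximal) (auto intro: image_eqI[of _ _ 0])
  then have one: "1 \<in> ?C" by (force intro: image_eqI[of _ _ 1])
  have "?g 1 = 0"
  proof (rule holomorphic_zero_on_open[of ?g ?C 0 "{t. a + t *s (z - a) \<in> W}"])
    show "?g holomorphic_on ?C"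
      using f connected_component_subset unfolding lhol_def by (blast intro: holomorphic_on_subset)
    show "open ?C" using T by (rule open_connected_component)
    show "open {t. a + t *s (z - a) \<in> W}" using W(1) by (rule open_line)
  qed (use W aS one in \<open>auto simp: connected_component_refl_eq\<close>)
  then show ?thesis by simp
qed

text \<open>Along (p + t q, p + cnj t q) the conjugate in the second slot cancels the antiholomorphy
  there, so the identity theorem in the single variable t carries the vanishing from real t, that is
  from the diagonal, to nearby pairs. The majorant \<open>b z * b w\<close> is the shape that
  Cauchy-Schwarz gives for kernels; it supplies the local bound for
  \<open>separately_holomorphic_diagonal\<close>.\<close>

lemma polarization:
  fixes S :: "(complex^'n::finite) set" and h :: "complex^'n \<Rightarrow> complex^'n \<Rightarrow> complex"
  assumes S: "open S" "starlike S"
    and h1: "\<And>w. w \<in> S \<Longrightarrow> lhol S (\<lambda>z. h z w)"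
    and h2: "\<And>z. z \<in> S \<Longrightarrow> lhol S (\<lambda>w. cnj (h z w))"
    and b: "\<And>z. 0 \<le> b z" "\<And>z w. z \<in> S \<Longrightarrow> w \<in> S \<Longrightarrow> cmod (h z w) \<le> b z * b w"
      "\<And>z. z \<in> S \<Longrightarrow> \<exists>r>0. \<exists>B. \<forall>w\<in>S \<inter> ball z r. b w \<le> B"
    and diag: "\<And>z. z \<in> S \<Longrightarrow> h z z = 0"
    and "z \<in> S" "w \<in> S"
  shows "h z w = 0"
proof -
  obtain a where a: "a \<in> S" "\<And>z. z \<in> S \<Longrightarrow> closed_segment a z \<subseteq> S"
    using S(2) unfolding starlike_def by blast
  obtain r where r: "r > 0" "ball a r \<subseteq> S"
    using S(1) a(1) by (meson open_contains_ball)
  have near: "h u v = 0" if u: "u \<in> ball a r" and v: "v \<in> ball a r" for u v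
  proof -
    \<comment> \<open>These solve p + \<i> q = u and p - \<i> q = v, so that the parameter \<i>
      yields the pair (u, v).\<close>
    define p where "p = (1/2) *s (u + v)"
    define q where "q = (-\<i>/2) *s (u - v)"
    \<comment> \<open>Convexity will make \<open>T\<close> connected; it contains \<i> and also 0,
      where real parameters accumulate.\<close>
    define T where "T = {t. p + t *s q \<in> ball a r} \<inter> {t. p + cnj t *s q \<in> ball a r}"
    have comm: "p + cnj t *s q = (p + cnj (t - s) *s q) + cnj s *s q" for s t
      by (simp add: vec_eq_iff algebra_simps)
    have cont: "continuous_on UNIV (\<lambda>t. p + cnj t *s q)"
      by (intro continuous_intros)
    have op1: "open {t. p + t *s q \<in> V}" and op2: "open {t. p + cnj t *s q \<in> V}" if "open V" for V
      using open_line[OF that] open_vimage[OF that cont] by (simp_all add: vimage_def)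
    have T: "open T" unfolding T_def by (intro open_Int op1 op2) auto
    have lin: "p + ((1 - x) *\<^sub>R s + x *\<^sub>R t) *s q = (1 - x) *\<^sub>R (p + s *s q) + x *\<^sub>R (p + t *s q)"
      for x :: real and s t
      by (simp add: vec_eq_iff) (simp add: scaleR_conv_of_real algebra_simps)
    have "convex T"
      unfolding convex_alt
    proof (intro ballI allI impI)
      fix s t :: complex and x :: real
      assume st: "s \<in> T" "t \<in> T" and x: "0 \<le> x \<and> x \<le> 1"
      have "cnj ((1 - x) *\<^sub>R s + x *\<^sub>R t) = (1 - x) *\<^sub>R cnj s + x *\<^sub>R cnj t" by simp
      with st x show "(1 - x) *\<^sub>R s + x *\<^sub>R t \<in> T"
        using convex_ball[of a r] unfolding T_def convex_alt by (simp only: lin Int_iff mem_Collect_eq)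
    qed
    have i: "p + \<i> *s q = u" "p + cnj \<i> *s q = v"
      by (simp_all add: p_def q_def vec_eq_iff field_simps)
    have "p = (1 - 1/2) *\<^sub>R u + (1/2) *\<^sub>R v"
      by (simp add: p_def vec_eq_iff scaleR_conv_of_real[where 'a=complex] field_simps)
    then have pB: "p \<in> ball a r"
      using convexD_alt[OF convex_ball u v, of "1/2"] by simp
    have hol: "(\<lambda>t. h (p + t *s q) (p + cnj t *s q)) field_differentiable (at t0)" if t0: "t0 \<in> T" for t0
    proof -
      have S0: "p + t0 *s q \<in> S" "p + cnj t0 *s q \<in> S" using t0 r(2) by (auto simp: T_def)
      obtain r1 B1 where 1: "r1 > 0" "\<And>w. w \<in> S \<inter> ball (p + t0 *s q) r1 \<Longrightarrow> b w \<le> B1"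
        using b(3)[OF S0(1)] by blast
      obtain r2 B2 where 2: "r2 > 0" "\<And>w. w \<in> S \<inter> ball (p + cnj t0 *s q) r2 \<Longrightarrow> b w \<le> B2"
        using b(3)[OF S0(2)] by blast
      let ?V = "T \<inter> {t. p + t *s q \<in> ball (p + t0 *s q) r1} \<inter> {t. p + cnj t *s q \<in> ball (p + cnj t0 *s q) r2}"
      have "open ?V" by (intro open_Int op1 op2 T) auto
      moreover have "t0 \<in> ?V" using t0 1(1) 2(1) by simp
      ultimately obtain e where e: "e > 0" "ball t0 e \<subseteq> ?V" by (meson open_contains_ball)
      have inS: "p + t *s q \<in> S" "p + cnj t *s q \<in> S" if "t \<in> ball t0 e" for t
        using subsetD[OF e(2) that] r(2) by (auto simp: T_def)
      show ?thesis
      proof (rule separately_holomorphic_diagonal[OF e(1), where k = "\<lambda>s t. h (p + s *s q) (p + cnj t *s q)"])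
        fix t assume t: "t \<in> ball t0 e"
        show "(\<lambda>s. h (p + s *s q) (p + cnj t *s q)) holomorphic_on ball t0 e"
          using h1[OF inS(2)[OF t]] inS(1) unfolding lhol_def by (blast intro: holomorphic_on_subset)
      next
        fix s assume s: "s \<in> ball t0 e"
        \<comment> \<open>Conjugating value and parameter together turns holomorphy of
          \<open>cnj (h z w)\<close> in w into holomorphy in t.\<close>
        have "(\<lambda>t. cnj (h (p + s *s q) (p + t *s q))) holomorphic_on cnj ` ball t0 e"
          using h2[OF inS(1)[OF s]] inS(2) unfolding lhol_def by (blast intro: holomorphic_on_subset)
        from holomorphic_on_compose_cnj_cnj[OF this]
        show "(\<lambda>t. h (p + s *s q) (p + cnj t *s q)) holomorphic_on ball t0 e"
          by (simp add: o_def)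
      next
        fix s t assume st: "s \<in> ball t0 e" "t \<in> ball t0 e"
        have "b (p + s *s q) \<le> B1" "b (p + cnj t *s q) \<le> B2"
          using inS st e(2) by (auto intro!: 1(2) 2(2))
        then have "b (p + s *s q) * b (p + cnj t *s q) \<le> B1 * B2"
          using b(1)[of "p + s *s q"] b(1)[of "p + cnj t *s q"] by (intro mult_mono) linarith+
        then show "cmod (h (p + s *s q) (p + cnj t *s q)) \<le> B1 * B2"
          using b(2)[OF inS(1)[OF st(1)] inS(2)[OF st(2)]] by linarith
      qed
    qed
    have "h (p + \<i> *s q) (p + cnj \<i> *s q) = 0"
    proof (rule analytic_continuation[of "\<lambda>t. h (p + t *s q) (p + cnj t *s q)" T "T \<inter> \<real>" 0])
      show "(\<lambda>t. h (p + t *s q) (p + cnj t *s q)) holomorphic_on T"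
        using hol by (auto simp: holomorphic_on_def intro: field_differentiable_at_within)
      show "0 islimpt T \<inter> \<real>"
        unfolding islimpt_approachable
      proof (intro allI impI)
        fix e :: real assume e: "e > 0"
        obtain d where d: "d > 0" "ball 0 d \<subseteq> T"
          using T pB by (metis (no_types, lifting) T_def Int_iff add.right_neutral complex_cnj_zero
              mem_Collect_eq open_contains_ball vector_smult_lzero)
        let ?x = "complex_of_real (min d e / 2)"
        have "?x \<in> ball 0 d" "?x \<noteq> 0" "dist ?x 0 < e" using d(1) e by (auto simp: dist_norm)
        then show "\<exists>x'\<in>T \<inter> \<real>. x' \<noteq> 0 \<and> dist x' 0 < e" using d(2) by (intro bexI[of _ ?x]) auto
      qed
      show "h (p + t *s q) (p + cnj t *s q) = 0" if "t \<in> T \<inter> \<real>" for t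
        using that diag r(2) by (auto simp: T_def Reals_cnj_iff)
    qed (use T \<open>convex T\<close> pB i u v in \<open>auto simp: T_def convex_connected\<close>)
    then show ?thesis by (simp only: i)
  qed
  have aB: "a \<in> ball a r" using r(1) by simp
  \<comment> \<open>The variables leave the ball in turn: the first while the second stays near
    \<open>a\<close>, then the second with the first arbitrary in \<open>S\<close>.\<close>
  have one: "h u v = 0" if "v \<in> ball a r" "u \<in> S" for u v
    using lhol_zero_on_starlike[of S "\<lambda>z. h z v" a "ball a r" u] near that h1 r(2) S(1) a(2) aB
    by (meson open_ball subsetD)
  have "cnj (h z w) = 0"
    using lhol_zero_on_starlike[of S "\<lambda>w. cnj (h z w)" a "ball a r" w] one h2 assms(9,10) S(1) a(2) aB
    by (metis complex_cnj_zero open_ball)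
  then show ?thesis by simp
qed

section \<open>Hilbert spaces on a carrier set\<close>

text \<open>Hilbert spaces given by a carrier set; the vectors will be functions, for which no type of
  the class \<open>real_inner\<close> is at hand.\<close>

locale hilbert_carrier = vector_space sc
  for sc :: "complex \<Rightarrow> 'v::ab_group_add \<Rightarrow> 'v" +
  fixes H :: "'v set" and ip :: "'v \<Rightarrow> 'v \<Rightarrow> complex"
  assumes zero_in: "0 \<in> H"
    and add_in: "F \<in> H \<Longrightarrow> G \<in> H \<Longrightarrow> F + G \<in> H"
    and scale_in: "F \<in> H \<Longrightarrow> sc c F \<in> H"
    and ip_add_left: "F \<in> H \<Longrightarrow> G \<in> H \<Longrightarrow> K \<in> H \<Longrightarrow> ip (F + G) K = ip F K + ip G K"
    and ip_scale_left: "F \<in> H \<Longrightarrow> K \<in> H \<Longrightarrow> ip (sc c F) K = c * ip F K"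
    and ip_cnj: "F \<in> H \<Longrightarrow> K \<in> H \<Longrightarrow> ip K F = cnj (ip F K)"
    and ip_ge_0: "F \<in> H \<Longrightarrow> 0 \<le> Re (ip F F)"
    and ip_eq_0: "F \<in> H \<Longrightarrow> ip F F = 0 \<Longrightarrow> F = 0"
    and complete: "(\<And>k. X k \<in> H) \<Longrightarrow>
      (\<And>e. e > 0 \<Longrightarrow> \<exists>N. \<forall>k\<ge>N. \<forall>l\<ge>N. sqrt (Re (ip (X k - X l) (X k - X l))) < e) \<Longrightarrow>
      \<exists>F\<in>H. (\<lambda>k::nat. sqrt (Re (ip (X k - F) (X k - F)))) \<longlonglongrightarrow> 0"
begin

definition nrm :: "'v \<Rightarrow> real" where
  "nrm F = sqrt (Re (ip F F))"

lemma minus_in: "F \<in> H \<Longrightarrow> - F \<in> H"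
  using scale_in[of F "-1"] by simp

lemma diff_in: "F \<in> H \<Longrightarrow> G \<in> H \<Longrightarrow> F - G \<in> H"
  using add_in[OF _ minus_in] by fastforce

lemmas carrier_intros = zero_in add_in scale_in minus_in diff_in

lemma ip_add_right: "F \<in> H \<Longrightarrow> G \<in> H \<Longrightarrow> K \<in> H \<Longrightarrow> ip K (F + G) = ip K F + ip K G"
  by (metis add_in complex_cnj_add ip_add_left ip_cnj)

lemma ip_scale_right: "F \<in> H \<Longrightarrow> K \<in> H \<Longrightarrow> ip K (sc c F) = cnj c * ip K F"
  by (metis complex_cnj_mult ip_cnj ip_scale_left scale_in)

lemma ip_minus_left: "F \<in> H \<Longrightarrow> K \<in> H \<Longrightarrow> ip (- F) K = - ip F K"
  using ip_scale_left[of F K "-1"] by simp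

lemma ip_minus_right: "F \<in> H \<Longrightarrow> K \<in> H \<Longrightarrow> ip K (- F) = - ip K F"
  using ip_scale_right[of F K "-1"] by simp

lemma ip_diff_left: "F \<in> H \<Longrightarrow> G \<in> H \<Longrightarrow> K \<in> H \<Longrightarrow> ip (F - G) K = ip F K - ip G K"
  using ip_add_left[of F "- G" K] by (simp add: minus_in ip_minus_left)

lemma ip_diff_right: "F \<in> H \<Longrightarrow> G \<in> H \<Longrightarrow> K \<in> H \<Longrightarrow> ip K (F - G) = ip K F - ip K G"
  using ip_add_right[of F "- G" K] by (simp add: minus_in ip_minus_right)

lemma ip_zero_left: "K \<in> H \<Longrightarrow> ip 0 K = 0"
  using ip_scale_left[of K K 0] by simp

lemma ip_zero_right: "K \<in> H \<Longrightarrow> ip K 0 = 0"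
  using ip_scale_right[of K K 0] by simp

lemmas ip_simps = ip_add_left ip_add_right ip_scale_left ip_scale_right ip_minus_left ip_minus_right
  ip_diff_left ip_diff_right ip_zero_left ip_zero_right carrier_intros

lemma ip_self: "F \<in> H \<Longrightarrow> ip F F = of_real ((nrm F)\<^sup>2)"
proof -
  assume F: "F \<in> H"
  have "Im (ip F F) = 0" using ip_cnj[OF F F] by (metis cnj.sel(2) neg_equal_zero)
  then show ?thesis using ip_ge_0[OF F] by (simp add: nrm_def complex_eq_iff)
qed

lemma nrm_ge_0 [simp]: "F \<in> H \<Longrightarrow> 0 \<le> nrm F"
  using ip_ge_0 by (simp add: nrm_def)

lemma nrm_eq_0: "F \<in> H \<Longrightarrow> nrm F = 0 \<Longrightarrow> F = 0"
  using ip_eq_0 ip_self by simp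

lemma nrm_zero [simp]: "nrm 0 = 0"
  by (simp add: nrm_def ip_zero_left zero_in)

lemma nrm_scale: "F \<in> H \<Longrightarrow> nrm (sc c F) = cmod c * nrm F"
proof -
  assume F: "F \<in> H"
  have "ip (sc c F) (sc c F) = c * cnj c * ip F F" using F by (simp add: ip_simps)
  also have "\<dots> = of_real ((cmod c * nrm F)\<^sup>2)"
    unfolding ip_self[OF F] by (simp add: complex_norm_square[symmetric] power_mult_distrib)
  finally show ?thesis using F by (simp add: nrm_def[of "sc c F"])
qed

lemma nrm_minus: "F \<in> H \<Longrightarrow> nrm (- F) = nrm F"
  using nrm_scale[of F "-1"] by simp

lemma nrm_minus_commute: "F \<in> H \<Longrightarrow> G \<in> H \<Longrightarrow> nrm (F - G) = nrm (G - F)"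
  using nrm_minus[of "F - G"] by (simp add: diff_in)

lemma nrm_add_sq:
  assumes "F \<in> H" "G \<in> H"
  shows "(nrm (F + G))\<^sup>2 = (nrm F)\<^sup>2 + 2 * Re (ip F G) + (nrm G)\<^sup>2"
proof -
  have "complex_of_real ((nrm (F + G))\<^sup>2) = ip F F + (ip F G + cnj (ip F G)) + ip G G"
    using assms by (simp add: ip_self[symmetric] ip_simps ip_cnj[of F G] del: of_real_power)
  also have "\<dots> = of_real ((nrm F)\<^sup>2 + 2 * Re (ip F G) + (nrm G)\<^sup>2)"
    using assms by (simp add: ip_self complex_add_cnj)
  finally show ?thesis by (simp only: of_real_eq_iff)
qed

lemma nrm_diff_sq:
  assumes "F \<in> H" "G \<in> H"
  shows "(nrm (F - G))\<^sup>2 = (nrm F)\<^sup>2 - 2 * Re (ip F G) + (nrm G)\<^sup>2"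
  using nrm_add_sq[of F "- G"] assms by (simp add: minus_in ip_minus_right nrm_minus)

lemma Cauchy_Schwarz:
  assumes F: "F \<in> H" and G: "G \<in> H"
  shows "cmod (ip F G) \<le> nrm F * nrm G"
proof (cases "nrm G = 0")
  case True
  then show ?thesis using nrm_eq_0[OF G] F by (simp add: ip_zero_right)
next
  case False
  define g where "g = (nrm G)\<^sup>2"
  have g: "g > 0" "ip G G = of_real g" using False G by (simp_all add: g_def ip_self)
  define c where "c = ip F G / of_real g"
  have "ip (F - sc c G) (F - sc c G) = ip F F - cnj c * ip F G - c * ip G F + c * cnj c * ip G G"
    using F G by (simp add: ip_simps algebra_simps)
  also have "ip G F = cnj (ip F G)" using F G by (rule ip_cnj)
  also have "ip F F - cnj c * ip F G - c * cnj (ip F G) + c * cnj c * ip G G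
      = ip F F - ip F G * cnj (ip F G) / of_real g"
    using g by (simp add: c_def field_simps)
  also have "\<dots> = of_real ((nrm F)\<^sup>2 - (cmod (ip F G))\<^sup>2 / g)"
    using F by (simp add: ip_self complex_norm_square[symmetric])
  finally have "0 \<le> (nrm F)\<^sup>2 - (cmod (ip F G))\<^sup>2 / g"
    using ip_ge_0[of "F - sc c G"] F G by (simp add: carrier_intros)
  then have "(cmod (ip F G))\<^sup>2 \<le> (nrm F * nrm G)\<^sup>2"
    using g(1) by (simp add: g_def field_simps)
  then show ?thesis by (rule power2_le_imp_le) (simp add: F G)
qed

lemma nrm_triangle:
  assumes F: "F \<in> H" and G: "G \<in> H"
  shows "nrm (F + G) \<le> nrm F + nrm G"
proof (rule power2_le_imp_le)
  have "Re (ip F G) \<le> nrm F * nrm G"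
    using complex_Re_le_cmod[of "ip F G"] Cauchy_Schwarz[OF F G] by linarith
  then show "(nrm (F + G))\<^sup>2 \<le> (nrm F + nrm G)\<^sup>2"
    unfolding nrm_add_sq[OF F G] by (simp add: power2_sum)
qed (use F G in simp)

lemma nrm_triangle_diff:
  assumes "F \<in> H" "G \<in> H" "K \<in> H"
  shows "nrm (F - K) \<le> nrm (F - G) + nrm (G - K)"
  using nrm_triangle[of "F - G" "G - K"] assms by (simp add: diff_in)

lemma nrm_diff_le:
  assumes "F \<in> H" "G \<in> H"
  shows "nrm F \<le> nrm G + nrm (F - G)"
  using nrm_triangle[of G "F - G"] assms by (simp add: diff_in)

definition hsubspace :: "'v set \<Rightarrow> bool" where
  "hsubspace N \<longleftrightarrow> N \<subseteq> H \<and> 0 \<in> N \<and> (\<forall>F\<in>N. \<forall>G\<in>N. F + G \<in> N) \<and> (\<forall>F\<in>N. \<forall>c. sc c F \<in> N)"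

definition hclosure :: "'v set \<Rightarrow> 'v set" where
  "hclosure N = {F \<in> H. \<forall>e>0. \<exists>G\<in>N. nrm (F - G) < e}"

lemma complete_nrm:
  assumes "\<And>k. X k \<in> H" "\<And>e. e > 0 \<Longrightarrow> \<exists>N. \<forall>k\<ge>N. \<forall>l\<ge>N. nrm (X k - X l) < e"
  shows "\<exists>F\<in>H. (\<lambda>k::nat. nrm (X k - F)) \<longlonglongrightarrow> 0"
  using complete[OF assms[unfolded nrm_def]] unfolding nrm_def by blast

text \<open>A minimizing sequence is Cauchy by the parallelogram law. Its limit is only known to lie
  in the closure, since \<open>N\<close> need not be closed.\<close>

lemma closest_point:
  assumes N: "hsubspace N" and F: "F \<in> H"
  shows "\<exists>p\<in>hclosure N. \<forall>G\<in>N. nrm (F - p) \<le> nrm (F - G)"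
proof -
  have NH: "G \<in> H" if "G \<in> N" for G using N that by (auto simp: hsubspace_def)
  define d where "d = (INF G\<in>N. nrm (F - G))"
  have bdd: "bdd_below ((\<lambda>G. nrm (F - G)) ` N)"
    using F NH by (auto intro!: bdd_belowI2[of _ 0] simp: diff_in)
  have d_le: "d \<le> nrm (F - G)" if "G \<in> N" for G
    unfolding d_def using bdd that by (rule cINF_lower)
  have d0: "0 \<le> d"
    unfolding d_def using N F NH by (intro cINF_greatest) (auto simp: hsubspace_def diff_in)
  have "\<exists>G\<in>N. nrm (F - G) < d + 1 / real (Suc k)" for k
  proof -
    have "(INF G\<in>N. nrm (F - G)) < d + 1 / real (Suc k)" by (simp add: d_def)
    then show ?thesis using N bdd by (subst (asm) cINF_less_iff) (auto simp: hsubspace_def)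
  qed
  then obtain X where X: "\<And>k. X k \<in> N" "\<And>k. nrm (F - X k) < d + 1 / real (Suc k)" by metis
  have XH: "X k \<in> H" for k using X(1) NH by blast
  \<comment> \<open>The midpoint of \<open>X k\<close> and \<open>X l\<close> lies in
    \<open>N\<close>, so its distance from \<open>F\<close> is at least \<open>d\<close>; the rest
    is the parallelogram law for \<open>?a\<close> and \<open>?b\<close>.\<close>
  have mid: "(nrm (X k - X l))\<^sup>2 \<le> 2 * (nrm (F - X k))\<^sup>2 + 2 * (nrm (F - X l))\<^sup>2 - 4 * d\<^sup>2" for k l
  proof -
    let ?a = "F - X k" and ?b = "F - X l"
    have ab: "?a \<in> H" "?b \<in> H" using F XH by (auto simp: diff_in)
    have "sc (1/2) (X k + X l) \<in> N" using N X(1) by (auto simp: hsubspace_def)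
    then have "d \<le> nrm (F - sc (1/2) (X k + X l))" by (rule d_le)
    also have "F - sc (1/2) (X k + X l) = sc (1/2) (?a + ?b)"
    proof -
      have "sc (1/2) F + sc (1/2) F = F" by (simp add: scale_left_distrib[symmetric])
      then show ?thesis by (simp add: scale_right_distrib scale_right_diff_distrib algebra_simps)
    qed
    also have "nrm \<dots> = nrm (?a + ?b) / 2" using ab by (simp add: nrm_scale add_in)
    finally have "(2 * d)\<^sup>2 \<le> (nrm (?a + ?b))\<^sup>2" using d0 by (intro power_mono) auto
    moreover have "X k - X l = ?b - ?a" by simp
    moreover have "(nrm (?a + ?b))\<^sup>2 + (nrm (?b - ?a))\<^sup>2 = 2 * (nrm ?a)\<^sup>2 + 2 * (nrm ?b)\<^sup>2"
      using nrm_add_sq[OF ab(2,1)] nrm_diff_sq[OF ab(2,1)] by (simp add: add.commute)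
    ultimately show ?thesis by (simp add: power_mult_distrib)
  qed
  have lim: "(\<lambda>k. nrm (F - X k)) \<longlonglongrightarrow> d"
  proof (rule tendsto_sandwich[of "\<lambda>_. d" _ _ "\<lambda>k. d + 1 / real (Suc k)"])
    show "(\<lambda>k. d + 1 / real (Suc k)) \<longlonglongrightarrow> d"
      using tendsto_add[OF tendsto_const[of d] LIMSEQ_inverse_real_of_nat] by (simp add: inverse_eq_divide)
  qed (use d_le X in \<open>auto intro!: always_eventually less_imp_le simp del: of_nat_Suc\<close>)
  have "\<exists>N. \<forall>k\<ge>N. \<forall>l\<ge>N. nrm (X k - X l) < e" if e: "e > 0" for e
  proof -
    have "(\<lambda>k. (nrm (F - X k))\<^sup>2) \<longlonglongrightarrow> d\<^sup>2" using lim by (intro tendsto_intros)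
    then have "\<forall>\<^sub>F k in sequentially. (nrm (F - X k))\<^sup>2 < d\<^sup>2 + e\<^sup>2 / 4"
      using e by (intro order_tendstoD(2)[of _ "d\<^sup>2"]) simp_all
    then obtain K where K: "\<And>k. k \<ge> K \<Longrightarrow> (nrm (F - X k))\<^sup>2 < d\<^sup>2 + e\<^sup>2 / 4"
      unfolding eventually_sequentially by blast
    have "nrm (X k - X l) < e" if "k \<ge> K" "l \<ge> K" for k l
    proof (rule power2_less_imp_less)
      show "(nrm (X k - X l))\<^sup>2 < e\<^sup>2" using mid[of k l] K[OF that(1)] K[OF that(2)] by linarith
    qed (use e in simp)
    then show ?thesis by blast
  qed
  then obtain p where p: "p \<in> H" "(\<lambda>k. nrm (X k - p)) \<longlonglongrightarrow> 0"
    using complete_nrm[of X] XH by blast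
  have "p \<in> hclosure N"
    unfolding hclosure_def
  proof (intro CollectI conjI p allI impI)
    fix e :: real assume "e > 0"
    then have "\<forall>\<^sub>F k in sequentially. nrm (X k - p) < e" by (rule order_tendstoD(2)[OF p(2)])
    then obtain k where "nrm (X k - p) < e" by (meson eventually_sequentially order_refl)
    then show "\<exists>G\<in>N. nrm (p - G) < e" using X(1) XH p(1) nrm_minus_commute by metis
  qed
  moreover have "nrm (F - p) \<le> d"
  proof (rule LIMSEQ_le_const)
    have "(\<lambda>k. nrm (F - X k) + nrm (X k - p)) \<longlonglongrightarrow> d + 0" using lim p(2) by (rule tendsto_add)
    then show "(\<lambda>k. nrm (F - X k) + nrm (X k - p)) \<longlonglongrightarrow> d" by simp
    show "\<exists>N. \<forall>k\<ge>N. nrm (F - p) \<le> nrm (F - X k) + nrm (X k - p)"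
      using nrm_triangle_diff F XH p(1) by blast
  qed
  ultimately show ?thesis using d_le by (meson order_trans)
qed

text \<open>The error of the best approximation cannot be shortened by moving in a direction of
  \<open>N\<close>, which forces orthogonality.\<close>

lemma orthogonal_decomposition:
  assumes N: "hsubspace N" and F: "F \<in> H"
  shows "\<exists>h\<in>H. F - h \<in> hclosure N \<and> (\<forall>G\<in>N. ip h G = 0)"
proof -
  obtain p where p: "p \<in> hclosure N" "\<And>G. G \<in> N \<Longrightarrow> nrm (F - p) \<le> nrm (F - G)"
    using closest_point[OF assms] by blast
  have pH: "p \<in> H" using p(1) by (simp add: hclosure_def)
  let ?h = "F - p"
  have h: "?h \<in> H" using F pH by (rule diff_in)
  have NH: "G \<in> H" if "G \<in> N" for G using N that by (auto simp: hsubspace_def)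
  \<comment> \<open>Since \<open>p\<close> is only a limit of points of \<open>N\<close>, it is
    replaced by a nearby \<open>Q\<close> in \<open>N\<close> at the cost of
    \<open>e\<close>.\<close>
  have closest: "nrm ?h \<le> nrm (?h - G)" if G: "G \<in> N" for G
  proof (rule field_le_epsilon)
    fix e :: real assume "e > 0"
    then obtain Q where Q: "Q \<in> N" "nrm (p - Q) < e" using p(1) by (auto simp: hclosure_def)
    have "nrm ?h \<le> nrm (F - (Q + G))" using p(2) Q(1) G N by (auto simp: hsubspace_def)
    also have "F - (Q + G) = (?h - G) + (p - Q)" by (simp add: algebra_simps)
    also have "nrm \<dots> \<le> nrm (?h - G) + nrm (p - Q)"
      using F h NH[OF G] NH[OF Q(1)] pH by (intro nrm_triangle diff_in) auto
    finally show "nrm ?h \<le> nrm (?h - G) + e" using Q(2) by simp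
  qed
  have "ip ?h G = 0" if G: "G \<in> N" for G
  proof (cases "nrm G = 0")
    case True
    then show ?thesis using nrm_eq_0[OF NH[OF G]] h by (simp add: ip_zero_right)
  next
    case False
    define g where "g = (nrm G)\<^sup>2"
    have g: "g > 0" using False by (simp add: g_def)
    \<comment> \<open>With this coefficient \<open>sc c G\<close> is the projection of the error
      onto \<open>G\<close>; subtracting it lowers the squared norm by the squared modulus of
      \<open>ip ?h G\<close> over \<open>g\<close>.\<close>
    define c where "c = ip ?h G / of_real g"
    have cG: "sc c G \<in> N" "sc c G \<in> H" using N G NH by (auto simp: hsubspace_def)
    have "(nrm ?h)\<^sup>2 \<le> (nrm (?h - sc c G))\<^sup>2"
      using closest[OF cG(1)] h by (intro power_mono) auto
    also have "\<dots> = (nrm ?h)\<^sup>2 - 2 * Re (ip ?h (sc c G)) + (nrm (sc c G))\<^sup>2"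
      using h cG(2) by (rule nrm_diff_sq)
    also have "(nrm (sc c G))\<^sup>2 = (cmod (ip ?h G))\<^sup>2 / g"
      using g NH[OF G] by (simp add: nrm_scale c_def norm_divide power_mult_distrib power_divide g_def[symmetric])
        (simp add: power2_eq_square)
    also have "ip ?h (sc c G) = of_real ((cmod (ip ?h G))\<^sup>2 / g)"
      using h NH[OF G] by (simp add: ip_scale_right c_def complex_norm_square[symmetric] mult.commute)
    finally have "(cmod (ip ?h G))\<^sup>2 / g \<le> 0" by simp
    then show ?thesis using g by (simp add: divide_le_0_iff)
  qed
  then show ?thesis using p(1) h by (intro bexI[of _ ?h]) auto
qed

text \<open>The representing vector is a multiple of a vector \<open>h\<close> orthogonal to the
  kernel of \<open>L\<close>. Boundedness makes \<open>L\<close> vanish on the closure of its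
  kernel, and therefore \<open>L h\<close> is nonzero.\<close>

lemma Riesz:
  assumes add: "\<And>F G. F \<in> H \<Longrightarrow> G \<in> H \<Longrightarrow> L (F + G) = L F + L G"
    and scale: "\<And>F c. F \<in> H \<Longrightarrow> L (sc c F) = c * L F"
    and bound: "\<And>F. F \<in> H \<Longrightarrow> cmod (L F) \<le> B * nrm F"
  shows "\<exists>k\<in>H. \<forall>F\<in>H. L F = ip F k"
proof (cases "\<forall>F\<in>H. L F = 0")
  case True
  then show ?thesis by (intro bexI[of _ 0]) (auto simp: ip_zero_right zero_in)
next
  case False
  then obtain F0 where F0: "F0 \<in> H" "L F0 \<noteq> 0" by blast
  define N where "N = {F\<in>H. L F = 0}"
  have L0: "L 0 = 0" using scale[OF zero_in, of 0] by simp
  have Ldiff: "L (F - G) = L F - L G" if "F \<in> H" "G \<in> H" for F G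
    using add[of F "sc (-1) G"] scale[of G "-1"] scale_in[of G "-1"] that by simp
  have N: "hsubspace N" unfolding hsubspace_def N_def by (auto simp: add scale L0 carrier_intros)
  obtain h where h: "h \<in> H" "F0 - h \<in> hclosure N" "\<And>G. G \<in> N \<Longrightarrow> ip h G = 0"
    using orthogonal_decomposition[OF N F0(1)] by blast
  have clN: "L F = 0" if F: "F \<in> hclosure N" for F
  proof -
    have FH: "F \<in> H" using F by (simp add: hclosure_def)
    have "cmod (L F) \<le> e" if e: "e > 0" for e
    proof -
      have "e / (\<bar>B\<bar> + 1) > 0" using e by simp
      then obtain G where G: "G \<in> N" "nrm (F - G) < e / (\<bar>B\<bar> + 1)" using F unfolding hclosure_def by blast
      have GH: "G \<in> H" "L G = 0" using G by (auto simp: N_def)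
      have "cmod (L F) = cmod (L (F - G))" using GH FH by (simp add: Ldiff)
      also have "\<dots> \<le> B * nrm (F - G)" using FH GH by (intro bound diff_in)
      also have "\<dots> \<le> (\<bar>B\<bar> + 1) * (e / (\<bar>B\<bar> + 1))"
        using G(2) FH GH by (intro mult_mono) (auto simp: diff_in)
      also have "\<dots> = e" by simp
      finally show ?thesis .
    qed
    then have "cmod (L F) \<le> 0" by (rule field_le_epsilon) simp
    then show ?thesis by simp
  qed
  have Lh: "L h \<noteq> 0" using clN[OF h(2)] Ldiff[OF F0(1) h(1)] F0(2) by simp
  then have "h \<noteq> 0" using L0 by blast
  then have hh: "ip h h \<noteq> 0" using ip_eq_0 h(1) by blast
  \<comment> \<open>The scalar is chosen so that \<open>ip h k\<close> equals
    \<open>L h\<close>.\<close>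
  define k where "k = sc (cnj (L h / ip h h)) h"
  have "L F = ip F k" if F: "F \<in> H" for F
  proof -
    have "F - sc (L F / L h) h \<in> N"
      using F h(1) Lh by (simp add: N_def Ldiff scale carrier_intros)
    then have "ip h (F - sc (L F / L h) h) = 0" by (rule h(3))
    then have "ip (F - sc (L F / L h) h) h = 0"
      using ip_cnj[of h "F - sc (L F / L h) h"] F h(1) by (simp add: carrier_intros)
    then have "ip F h = L F / L h * ip h h" using F h(1) by (simp add: ip_simps)
    then show ?thesis using F h(1) Lh hh by (simp add: k_def ip_scale_right)
  qed
  moreover have "k \<in> H" using h(1) by (simp add: k_def scale_in)
  ultimately show ?thesis by blast
qed

lemma sum_in:
  "(\<And>i. i \<in> I \<Longrightarrow> G i \<in> H) \<Longrightarrow> sum G I \<in> H"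
  by (induction I rule: infinite_finite_induct) (auto intro: carrier_intros)

lemma additive_sum:
  assumes "L 0 = 0" "\<And>F G. F \<in> H \<Longrightarrow> G \<in> H \<Longrightarrow> L (F + G) = L F + L G"
  shows "(\<And>i. i \<in> I \<Longrightarrow> G i \<in> H) \<Longrightarrow> L (sum G I) = (\<Sum>i\<in>I. L (G i))"
  by (induction I rule: infinite_finite_induct) (simp_all add: assms sum_in)

lemma tendsto_ip_right:
  assumes F: "F \<in> H" and G: "G \<in> H" and X: "\<And>k. X k \<in> H" and lim: "(\<lambda>k. nrm (X k - G)) \<longlonglongrightarrow> 0"
  shows "(\<lambda>k. ip F (X k)) \<longlonglongrightarrow> ip F G"
proof (rule LIM_zero_cancel, rule Lim_null_comparison)
  have "cmod (ip F (X k) - ip F G) \<le> nrm F * nrm (X k - G)" for k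
    using Cauchy_Schwarz[of F "X k - G"] F G X by (simp add: ip_simps)
  then show "\<forall>\<^sub>F k in sequentially. norm (ip F (X k) - ip F G) \<le> nrm F * nrm (X k - G)" by simp
  show "(\<lambda>k. nrm F * nrm (X k - G)) \<longlonglongrightarrow> 0"
    using tendsto_mult[OF tendsto_const lim, of "nrm F"] by simp
qed

end

section \<open>Reproducing kernels\<close>

definition cip :: "complex^'m::finite \<Rightarrow> complex^'m \<Rightarrow> complex" where
  "cip x y = (\<Sum>i\<in>UNIV. x $ i * cnj (y $ i))"

definition adj :: "complex^'m::finite^'k::finite \<Rightarrow> complex^'k^'m" where
  "adj A = (\<chi> i j. cnj (A $ j $ i))"

lemma cip_add_left: "cip (x + y) z = cip x z + cip y z"
  by (simp add: cip_def sum.distrib distrib_right)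

lemma cip_add_right: "cip z (x + y) = cip z x + cip z y"
  by (simp add: cip_def sum.distrib distrib_left)

lemma cip_scale_left: "cip (c *s x) y = c * cip x y"
  by (simp add: cip_def sum_distrib_left mult.assoc)

lemma cip_cnj: "cnj (cip x y) = cip y x"
  by (simp add: cip_def mult.commute)

lemma cip_self: "cip x x = of_real ((norm x)\<^sup>2)"
  by (simp add: cip_def norm_vec_def L2_set_def sum_nonneg complex_norm_square[symmetric])

lemma cip_zero_left [simp]: "cip 0 y = 0" and cip_zero_right [simp]: "cip x 0 = 0"
  by (simp_all add: cip_def)

lemma cip_diff_left: "cip (x - y) z = cip x z - cip y z"
  by (simp add: cip_def sum_subtractf left_diff_distrib)

lemma cip_diff_right: "cip z (x - y) = cip z x - cip z y"
  by (simp add: cip_def sum_subtractf right_diff_distrib)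

lemma cip_Cauchy_Schwarz: "cmod (cip x y) \<le> norm x * norm y"
proof -
  have "cmod (cip x y) \<le> (\<Sum>i\<in>UNIV. \<bar>cmod (x $ i)\<bar> * \<bar>cmod (y $ i)\<bar>)"
    unfolding cip_def by (rule order_trans[OF norm_sum]) (simp add: norm_mult)
  also have "\<dots> \<le> norm x * norm y"
    unfolding norm_vec_def by (rule L2_set_mult_ineq)
  finally show ?thesis .
qed

lemma cip_eqI: "(\<And>u. cip x u = cip y u) \<Longrightarrow> x = y"
  using cip_self[of "x - y"] by (simp add: cip_diff_left)

lemma cip_eqI_right: "(\<And>u. cip u x = cip u y) \<Longrightarrow> x = y"
  using cip_self[of "x - y"] by (simp add: cip_diff_right)

lemma cip_adj: "cip (A *v x) y = cip x (adj A *v y)"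
proof -
  have "cip (A *v x) y = (\<Sum>i\<in>UNIV. \<Sum>j\<in>UNIV. A $ i $ j * x $ j * cnj (y $ i))"
    by (simp add: cip_def matrix_vector_mult_def sum_distrib_right)
  also have "\<dots> = (\<Sum>j\<in>UNIV. \<Sum>i\<in>UNIV. A $ i $ j * x $ j * cnj (y $ i))"
    by (rule sum.swap)
  also have "\<dots> = cip x (adj A *v y)"
    by (simp add: cip_def adj_def matrix_vector_mult_def sum_distrib_left ac_simps)
  finally show ?thesis .
qed

lemma adj_adj [simp]: "adj (adj A) = A"
  by (simp add: adj_def vec_eq_iff)

section \<open>A unitary from two total families with equal Gram matrices\<close>

locale hilbert_pair = A: hilbert_carrier sc H ip + B: hilbert_carrier sc' H' ip'
  for sc :: "complex \<Rightarrow> 'v::ab_group_add \<Rightarrow> 'v" and H ip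
    and sc' :: "complex \<Rightarrow> 'w::ab_group_add \<Rightarrow> 'w" and H' ip' +
  fixes I :: "'i set" and x :: "'i \<Rightarrow> 'v" and y :: "'i \<Rightarrow> 'w"
  assumes x_in: "i \<in> I \<Longrightarrow> x i \<in> H" and y_in: "i \<in> I \<Longrightarrow> y i \<in> H'"
    and gram_eq: "i \<in> I \<Longrightarrow> j \<in> I \<Longrightarrow> ip (x i) (x j) = ip' (y i) (y j)"
    and total: "F \<in> H \<Longrightarrow> (\<And>i. i \<in> I \<Longrightarrow> ip F (x i) = 0) \<Longrightarrow> F = 0"
    and total': "F' \<in> H' \<Longrightarrow> (\<And>i. i \<in> I \<Longrightarrow> ip' F' (y i) = 0) \<Longrightarrow> F' = 0"
begin

text \<open>A relation, because a vector can have several representations as a combination of the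
  \<open>x i\<close>; that its partner does not depend on the choice is a consequence of the equal
  Gram matrices.\<close>

inductive span_pair :: "'v \<Rightarrow> 'w \<Rightarrow> bool" where
  span_pair_zero: "span_pair 0 0"
| span_pair_step: "span_pair F F' \<Longrightarrow> i \<in> I \<Longrightarrow> span_pair (F + sc a (x i)) (F' + sc' a (y i))"

lemma span_pair_in: "span_pair F F' \<Longrightarrow> F \<in> H \<and> F' \<in> H'"
  by (induction rule: span_pair.induct) (auto simp: A.carrier_intros B.carrier_intros x_in y_in)

lemma span_pair_add: "span_pair G G' \<Longrightarrow> span_pair F F' \<Longrightarrow> span_pair (F + G) (F' + G')"
  by (induction rule: span_pair.induct) (auto simp: add.assoc[symmetric] intro: span_pair_step)

lemma span_pair_scale: "span_pair F F' \<Longrightarrow> span_pair (sc c F) (sc' c F')"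
proof (induction rule: span_pair.induct)
  case (span_pair_step F F' i a)
  then show ?case
    using span_pair.span_pair_step[of "sc c F" "sc' c F'" i "c * a"]
    by (simp add: A.scale_right_distrib B.scale_right_distrib)
qed (simp add: span_pair_zero)

text \<open>The graph of the unitary, written weakly through inner products with the two families,
  so that uniqueness of partners is immediate from totality.\<close>

definition matched :: "'v \<Rightarrow> 'w \<Rightarrow> bool" where
  "matched F F' \<longleftrightarrow> F \<in> H \<and> F' \<in> H' \<and> (\<forall>i\<in>I. ip F (x i) = ip' F' (y i))"

lemma matched_span_pair: "span_pair G G' \<Longrightarrow> matched F F' \<Longrightarrow> ip F G = ip' F' G'"
proof (induction rule: span_pair.induct)
  case (span_pair_step G G' i a)
  then show ?case
    using span_pair_in[of G G'] by (simp add: matched_def A.ip_simps B.ip_simps x_in y_in)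
qed (simp add: matched_def A.ip_simps B.ip_simps)

lemma span_pair_matched: "span_pair F F' \<Longrightarrow> matched F F'"
proof (induction rule: span_pair.induct)
  case (span_pair_step F F' i a)
  then show ?case by (simp add: matched_def A.ip_simps B.ip_simps x_in y_in gram_eq)
qed (simp add: matched_def A.ip_simps B.ip_simps x_in y_in)

lemma span_pair_diff: "span_pair F F' \<Longrightarrow> span_pair G G' \<Longrightarrow> span_pair (F - G) (F' - G')"
  using span_pair_add[OF span_pair_scale[of G G' "-1"], of F F'] by simp

lemma span_pair_nrm: "span_pair F F' \<Longrightarrow> A.nrm F = B.nrm F'"
  using matched_span_pair[OF _ span_pair_matched] by (simp add: A.nrm_def B.nrm_def)

text \<open>A vector orthogonal to the span is orthogonal to every \<open>x i\<close> and hence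
  zero, so the orthogonal decomposition leaves only the part in the closure.\<close>

lemma span_pair_dense:
  assumes F: "F \<in> H"
  shows "F \<in> A.hclosure {G. \<exists>G'. span_pair G G'}"
proof -
  let ?D = "{G. \<exists>G'. span_pair G G'}"
  have D: "A.hsubspace ?D" unfolding A.hsubspace_def using span_pair_in span_pair_zero span_pair_add span_pair_scale by blast
  obtain h where h: "h \<in> H" "F - h \<in> A.hclosure ?D" "\<And>G. G \<in> ?D \<Longrightarrow> ip h G = 0"
    using A.orthogonal_decomposition[OF D F] by blast
  have "x i \<in> ?D" if "i \<in> I" for i using span_pair_step[OF span_pair_zero that, of 1] by auto
  then have "h = 0" using total[OF h(1)] h(3) by blast
  then show ?thesis using h(2) by simp
qed

text \<open>The correspondence on spans is isometric, so a Cauchy sequence has a Cauchy partner,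
  which converges by completeness of \<open>H'\<close>.\<close>

lemma approximation:
  assumes F: "F \<in> H"
  shows "\<exists>F' X X'. F' \<in> H' \<and> (\<forall>k. span_pair (X k) (X' k)) \<and> (\<lambda>k. A.nrm (X k - F)) \<longlonglongrightarrow> 0 \<and>
    (\<lambda>k. B.nrm (X' k - F')) \<longlonglongrightarrow> 0"
proof -
  have "\<exists>G G'. span_pair G G' \<and> A.nrm (F - G) < 1 / real (Suc k)" for k
    using span_pair_dense[OF F] unfolding A.hclosure_def by force
  then obtain X X' where X: "\<And>k. span_pair (X k) (X' k)" "\<And>k. A.nrm (F - X k) < 1 / real (Suc k)"
    by metis
  have XH: "X k \<in> H" "X' k \<in> H'" for k using span_pair_in[OF X(1)] by auto
  have lim: "(\<lambda>k. A.nrm (X k - F)) \<longlonglongrightarrow> 0"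
  proof (rule tendsto_sandwich[of "\<lambda>_. 0" _ _ "\<lambda>k. 1 / real (Suc k)"])
    show "(\<lambda>k. 1 / real (Suc k)) \<longlonglongrightarrow> 0"
      using LIMSEQ_inverse_real_of_nat by (simp add: inverse_eq_divide)
  qed (use X(2) XH F in \<open>auto intro!: always_eventually less_imp_le
      simp: A.nrm_minus_commute[of F] A.diff_in simp del: of_nat_Suc\<close>)
  have "\<exists>N. \<forall>k\<ge>N. \<forall>l\<ge>N. B.nrm (X' k - X' l) < e" if e: "e > 0" for e
  proof -
    have "\<forall>\<^sub>F k in sequentially. A.nrm (X k - F) < e / 2"
      using order_tendstoD(2)[OF lim, of "e / 2"] e by simp
    then obtain N where N: "\<And>k. k \<ge> N \<Longrightarrow> A.nrm (X k - F) < e / 2"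
      unfolding eventually_sequentially by blast
    have "B.nrm (X' k - X' l) < e" if kl: "k \<ge> N" "l \<ge> N" for k l
    proof -
      have "B.nrm (X' k - X' l) = A.nrm (X k - X l)" using span_pair_nrm span_pair_diff X(1) by metis
      also have "\<dots> \<le> A.nrm (X k - F) + A.nrm (F - X l)" using XH F by (intro A.nrm_triangle_diff)
      finally show ?thesis
        using N[OF kl(1)] N[OF kl(2)] A.nrm_minus_commute[OF F XH(1)[of l]] by linarith
    qed
    then show ?thesis by blast
  qed
  from B.complete_nrm[of X', OF XH(2) this] lim X(1) show ?thesis by blast
qed

lemma matched_exists:
  assumes F: "F \<in> H"
  shows "\<exists>F'. matched F F'"
proof -
  obtain F' X X' where X: "F' \<in> H'" "\<And>k. span_pair (X k) (X' k)" "(\<lambda>k. A.nrm (X k - F)) \<longlonglongrightarrow> 0"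
    "(\<lambda>k. B.nrm (X' k - F')) \<longlonglongrightarrow> 0"
    using approximation[OF F] by blast
  have XH: "X k \<in> H" "X' k \<in> H'" for k using span_pair_in[OF X(2)] by auto
  have "ip (x i) F = ip' (y i) F'" if i: "i \<in> I" for i
  proof (rule LIMSEQ_unique)
    show "(\<lambda>k. ip (x i) (X k)) \<longlonglongrightarrow> ip (x i) F"
      using x_in[OF i] F XH X(3) by (intro A.tendsto_ip_right)
    have "ip (x i) (X k) = ip' (y i) (X' k)" for k
      using matched_span_pair[OF X(2)] span_pair_matched[OF span_pair_step[OF span_pair_zero i, of 1]] by simp
    then show "(\<lambda>k. ip (x i) (X k)) \<longlonglongrightarrow> ip' (y i) F'"
      using y_in[OF i] X(1,4) XH by (simp add: B.tendsto_ip_right)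
  qed
  then have "ip F (x i) = ip' F' (y i)" if "i \<in> I" for i
    using A.ip_cnj[OF x_in[OF that] F] B.ip_cnj[OF y_in[OF that] X(1)] that by metis
  then show ?thesis using F X(1) unfolding matched_def by blast
qed

lemma matched_unique: "matched F F' \<Longrightarrow> matched F G' \<Longrightarrow> F' = G'"
  using total'[of "F' - G'"] by (simp add: matched_def B.ip_simps y_in)

text \<open>Approximating \<open>G\<close> by span pairs reduces the claim to
  \<open>matched_span_pair\<close>; the limit on the other side is a partner of \<open>G\<close> and
  so equals \<open>G'\<close> by uniqueness.\<close>

lemma matched_ip:
  assumes "matched F F'" "matched G G'"
  shows "ip' F' G' = ip F G"
proof -
  have FG: "F \<in> H" "F' \<in> H'" "G \<in> H" using assms by (auto simp: matched_def)
  obtain G'' X X' where X: "G'' \<in> H'" "\<And>k. span_pair (X k) (X' k)" "(\<lambda>k. A.nrm (X k - G)) \<longlonglongrightarrow> 0"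
    "(\<lambda>k. B.nrm (X' k - G'')) \<longlonglongrightarrow> 0"
    using approximation[OF FG(3)] by blast
  have XH: "X k \<in> H" "X' k \<in> H'" for k using span_pair_in[OF X(2)] by auto
  have lim: "ip D G = ip' D' G''" if "matched D D'" for D D'
  proof (rule LIMSEQ_unique)
    have D: "D \<in> H" "D' \<in> H'" using that by (auto simp: matched_def)
    show "(\<lambda>k. ip D (X k)) \<longlonglongrightarrow> ip D G"
      using D FG XH X(3) by (intro A.tendsto_ip_right)
    have "ip D (X k) = ip' D' (X' k)" for k using matched_span_pair[OF X(2) that] .
    then show "(\<lambda>k. ip D (X k)) \<longlonglongrightarrow> ip' D' G''"
      using D X(1,4) XH by (simp add: B.tendsto_ip_right)
  qed
  have "matched G G''"
    unfolding matched_def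
  proof (intro conjI ballI FG X)
    fix i assume i: "i \<in> I"
    have "ip (x i) G = ip' (y i) G''" using lim[OF span_pair_matched[OF span_pair_step[OF span_pair_zero i, of 1]]] by simp
    then show "ip G (x i) = ip' G'' (y i)"
      using A.ip_cnj[OF x_in[OF i] FG(3)] B.ip_cnj[OF y_in[OF i] X(1)] by metis
  qed
  then have "G'' = G'" using matched_unique assms(2) by blast
  then show ?thesis using lim[OF assms(1)] by simp
qed

end

text \<open>Uniqueness and existence of partners in the opposite direction become injectivity and
  surjectivity of the unitary.\<close>

lemma hilbert_pair_swap:
  assumes "hilbert_pair sc H ip sc' H' ip' I x y"
  shows "hilbert_pair sc' H' ip' sc H ip I y x"
proof -
  interpret hilbert_pair sc H ip sc' H' ip' I x y by fact
  show ?thesis by unfold_locales (auto simp: x_in y_in gram_eq intro: total total')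
qed

lemma (in hilbert_pair) unitary_exists:
  "\<exists>U. bij_betw U H H' \<and> (\<forall>F\<in>H. \<forall>i\<in>I. ip' (U F) (y i) = ip F (x i)) \<and>
       (\<forall>F\<in>H. \<forall>G\<in>H. ip' (U F) (U G) = ip F G)"
proof -
  interpret sw: hilbert_pair sc' H' ip' sc H ip I y x
    by (rule hilbert_pair_swap) unfold_locales
  define U where "U F = (SOME F'. matched F F')" for F
  have U: "matched F (U F)" if "F \<in> H" for F
    unfolding U_def using matched_exists[OF that] by (rule someI_ex)
  have matched_sym: "sw.matched F' F \<longleftrightarrow> matched F F'" for F F'
    unfolding matched_def sw.matched_def by auto
  have "inj_on U H"
    using U sw.matched_unique unfolding matched_sym by (metis inj_onI)
  moreover have "U ` H = H'"
  proof safe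
    show "U F \<in> H'" if "F \<in> H" for F using U[OF that] by (simp add: matched_def)
    show "F' \<in> U ` H" if F': "F' \<in> H'" for F'
    proof -
      obtain F where F: "matched F F'" using sw.matched_exists[OF F'] matched_sym by blast
      then have "F \<in> H" by (simp add: matched_def)
      then show ?thesis using F matched_unique U by blast
    qed
  qed
  ultimately have "bij_betw U H H'" by (simp add: bij_betw_def)
  then show ?thesis
    using U matched_ip by (intro exI[of _ U]) (auto simp: matched_def)
qed

section \<open>Reproducing kernels for vector-valued evaluations \<open>C z\<close> that need not be
  values of functions\<close>

locale rkhs = hilbert_carrier sc H ip for sc :: "complex \<Rightarrow> 'v::ab_group_add \<Rightarrow> 'v" and H ip +
  fixes S :: "(complex^'n::finite) set" and C :: "complex^'n \<Rightarrow> 'v \<Rightarrow> complex^'m::finite"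
  assumes C_add: "z \<in> S \<Longrightarrow> F \<in> H \<Longrightarrow> G \<in> H \<Longrightarrow> C z (F + G) = C z F + C z G"
    and C_scale: "z \<in> S \<Longrightarrow> F \<in> H \<Longrightarrow> C z (sc c F) = c *s C z F"
    and C_bound: "z \<in> S \<Longrightarrow> \<exists>r>0. \<exists>B. \<forall>w\<in>S \<inter> ball z r. \<forall>F\<in>H. norm (C w F) \<le> B * nrm F"
    and C_lhol: "F \<in> H \<Longrightarrow> lhol S (\<lambda>z. C z F $ i)"
    and C_total: "F \<in> H \<Longrightarrow> (\<And>z. z \<in> S \<Longrightarrow> C z F = 0) \<Longrightarrow> F = 0"
begin

lemma C_diff: "z \<in> S \<Longrightarrow> F \<in> H \<Longrightarrow> G \<in> H \<Longrightarrow> C z (F - G) = C z F - C z G"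
  using C_add[of z F "sc (-1) G"] C_scale[of z G "-1"] scale_in[of G "-1"] by simp

lemma C_eqI: "F \<in> H \<Longrightarrow> G \<in> H \<Longrightarrow> (\<And>z. z \<in> S \<Longrightarrow> C z F = C z G) \<Longrightarrow> F = G"
  using C_total[of "F - G"] by (simp add: C_diff diff_in)

text \<open>The adjoint of \<open>C z\<close> applied to \<open>v\<close>, obtained as a Riesz
  vector; the operator kernel at (z, w) sends \<open>v\<close> to
  \<open>C z (krn w v)\<close>.\<close>

definition krn :: "complex^'n \<Rightarrow> complex^'m \<Rightarrow> 'v" where
  "krn z v = (SOME k. k \<in> H \<and> (\<forall>F\<in>H. cip (C z F) v = ip F k))"

lemma krn:
  assumes z: "z \<in> S"
  shows krn_in: "krn z v \<in> H" and ip_krn: "F \<in> H \<Longrightarrow> ip F (krn z v) = cip (C z F) v"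
proof -
  obtain r B where r: "r > 0" "\<forall>w\<in>S \<inter> ball z r. \<forall>F\<in>H. norm (C w F) \<le> B * nrm F"
    using C_bound[OF z] by blast
  have "\<exists>k\<in>H. \<forall>F\<in>H. cip (C z F) v = ip F k"
  proof (rule Riesz)
    show "cmod (cip (C z F) v) \<le> (B * norm v) * nrm F" if F: "F \<in> H" for F
    proof -
      have "norm (C z F) \<le> B * nrm F" using r z F by auto
      then have "norm (C z F) * norm v \<le> B * nrm F * norm v" by (rule mult_right_mono) simp
      then show ?thesis using cip_Cauchy_Schwarz[of "C z F" v] by (simp add: mult_ac)
    qed
  qed (simp_all add: C_add C_scale z cip_add_left cip_scale_left)
  then have "\<exists>k. k \<in> H \<and> (\<forall>F\<in>H. cip (C z F) v = ip F k)" by blast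
  from someI_ex[OF this] have "krn z v \<in> H \<and> (\<forall>F\<in>H. cip (C z F) v = ip F (krn z v))"
    unfolding krn_def .
  then show "krn z v \<in> H" "F \<in> H \<Longrightarrow> ip F (krn z v) = cip (C z F) v" by simp_all
qed

lemma ip_krn_left: "z \<in> S \<Longrightarrow> F \<in> H \<Longrightarrow> ip (krn z v) F = cip v (C z F)"
  using ip_cnj[OF _ krn_in, of F z v] ip_krn[of z F v] by (simp add: cip_cnj)

lemma krn_unique:
  assumes "z \<in> S" "k \<in> H" "\<And>F. F \<in> H \<Longrightarrow> ip F k = cip (C z F) v"
  shows "k = krn z v"
proof -
  have "ip F (k - krn z v) = 0" if "F \<in> H" for F
    using assms that by (simp add: ip_simps krn_in ip_krn)
  then have "ip (k - krn z v) (k - krn z v) = 0"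
    using assms by (simp add: carrier_intros krn_in)
  then show ?thesis using ip_eq_0[of "k - krn z v"] assms by (simp add: carrier_intros krn_in)
qed

text \<open>The reproducing property bounds the squared norm of the kernel function by a constant
  times the norm itself, and one factor cancels. Polarization takes its local bound from
  here.\<close>

lemma nrm_krn_bound:
  assumes z: "z \<in> S"
  shows "\<exists>r>0. \<exists>B. \<forall>w\<in>S \<inter> ball z r. nrm (krn w v) \<le> B"
proof -
  obtain r B where r: "r > 0" "\<forall>w\<in>S \<inter> ball z r. \<forall>F\<in>H. norm (C w F) \<le> B * nrm F"
    using C_bound[OF z] by blast
  have "nrm (krn w v) \<le> \<bar>B\<bar> * norm v" if w: "w \<in> S \<inter> ball z r" for w
  proof (cases "nrm (krn w v) = 0")
    case False
    have wS: "w \<in> S" using w by simp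
    then have k: "krn w v \<in> H" by (rule krn_in)
    have "complex_of_real ((nrm (krn w v))\<^sup>2) = cip (C w (krn w v)) v"
      using ip_self[OF k] ip_krn[OF wS k] by simp
    then have "(nrm (krn w v))\<^sup>2 = cmod (cip (C w (krn w v)) v)"
      using norm_of_real[of "(nrm (krn w v))\<^sup>2", where 'a = complex] by (simp only: abs_power2)
    also have "\<dots> \<le> norm (C w (krn w v)) * norm v" by (rule cip_Cauchy_Schwarz)
    also have "\<dots> \<le> (B * nrm (krn w v)) * norm v" using r(2) w k by (intro mult_right_mono) auto
    also have "\<dots> \<le> (\<bar>B\<bar> * nrm (krn w v)) * norm v" using k by (intro mult_right_mono) auto
    finally have "nrm (krn w v) * nrm (krn w v) \<le> nrm (krn w v) * (\<bar>B\<bar> * norm v)"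
      by (simp add: power2_eq_square mult_ac)
    then show ?thesis using False nrm_ge_0[OF k] by (simp add: mult_le_cancel_left)
  qed simp
  then show ?thesis using r(1) by blast
qed

text \<open>In z this is a linear combination of the coordinates of the single vector
  \<open>krn w v\<close>.\<close>

lemma krn_lhol:
  assumes w: "w \<in> S"
  shows "lhol S (\<lambda>z. ip (krn w v) (krn z u))"
proof -
  have "ip (krn w v) (krn z u) = (\<Sum>i\<in>UNIV. C z (krn w v) $ i * cnj (u $ i))" if "z \<in> S" for z
    using ip_krn[OF that krn_in[OF w]] by (simp add: cip_def)
  then show ?thesis
    by (subst lhol_cong) (auto intro!: lhol_sum lhol_mult lhol_const C_lhol krn_in w)
qed

lemma krn_add:
  assumes z: "z \<in> S"
  shows "krn z (u + v) = krn z u + krn z v"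
proof (rule sym, rule krn_unique[OF z])
  show "krn z u + krn z v \<in> H" using z by (intro add_in krn_in)
  show "ip F (krn z u + krn z v) = cip (C z F) (u + v)" if "F \<in> H" for F
    using that z by (simp add: ip_add_right krn_in ip_krn cip_add_right)
qed

lemma krn_scale:
  assumes z: "z \<in> S"
  shows "krn z (c *s v) = sc c (krn z v)"
proof (rule sym, rule krn_unique[OF z])
  show "sc c (krn z v) \<in> H" using z by (intro scale_in krn_in)
  have "cip x (c *s v) = cnj c * cip x v" for x
    using arg_cong[OF cip_scale_left[of c v x], of cnj] by (simp add: cip_cnj)
  then show "ip F (sc c (krn z v)) = cip (C z F) (c *s v)" if "F \<in> H" for F
    using that z by (simp add: ip_scale_right krn_in ip_krn)
qed

text \<open>For the coordinates in a localization this is the inverse of the Gram matrix of the basis.\<close>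

definition gram :: "complex^'n \<Rightarrow> complex^'m^'m" where
  "gram z = matrix (\<lambda>v. C z (krn z v))"

lemma gram_mult:
  assumes z: "z \<in> S"
  shows "gram z *v v = C z (krn z v)"
proof -
  have "Vector_Spaces.linear (*s) (*s) (\<lambda>v. C z (krn z v))"
    by unfold_locales (simp_all add: krn_add krn_scale C_add C_scale krn_in z)
  then show ?thesis unfolding gram_def by (simp add: matrix_works)
qed

lemma ip_krn_krn: "z \<in> S \<Longrightarrow> ip (krn z v) (krn z u) = cip (gram z *v v) u"
  by (simp add: gram_mult ip_krn krn_in)

text \<open>If \<open>gram z\<close> kills \<open>v\<close>, the kernel function of \<open>v\<close>
  is zero, so \<open>v\<close> is orthogonal to the range of \<open>C z\<close>, which is
  everything.\<close>

lemma gram_invertible: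
  assumes z: "z \<in> S" and surj: "\<And>c. \<exists>F\<in>H. C z F = c"
  shows "invertible (gram z)"
proof -
  have "v = 0" if v: "gram z *v v = 0" for v
  proof -
    have "ip (krn z v) (krn z v) = 0" using ip_krn_krn[OF z] v by simp
    then have "krn z v = 0" using ip_eq_0 krn_in[OF z] by blast
    then have "cip (C z F) v = 0" if "F \<in> H" for F using ip_krn[OF z that, of v] that by (simp add: ip_zero_right)
    then have "cip c v = cip c 0" for c using surj[of c] by auto
    then show "v = 0" by (rule cip_eqI_right)
  qed
  then show ?thesis
    unfolding invertible_left_inverse matrix_left_invertible_ker by blast
qed

end

section \<open>Two spaces whose kernels agree on the diagonal\<close>

locale rkhs_pair = A: rkhs sc H ip S C + B: rkhs sc' H' ip' S C'
  for sc :: "complex \<Rightarrow> 'v::ab_group_add \<Rightarrow> 'v" and H ip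
    and sc' :: "complex \<Rightarrow> 'w::ab_group_add \<Rightarrow> 'w" and H' ip' and S :: "(complex^'n::finite) set"
    and C :: "complex^'n \<Rightarrow> 'v \<Rightarrow> complex^'m::finite" and C' :: "complex^'n \<Rightarrow> 'w \<Rightarrow> complex^'m" +
  assumes S_open: "open S" and S_starlike: "starlike S"
    and diagonal: "z \<in> S \<Longrightarrow> ip (A.krn z v) (A.krn z u) = ip' (B.krn z v) (B.krn z u)"
begin

text \<open>A kernel is holomorphic in one and antiholomorphic in the other variable, so that it is
  determined by its restriction to the diagonal.\<close>

lemma kernels_eq:
  assumes "z \<in> S" "w \<in> S"
  shows "ip (A.krn w v) (A.krn z u) = ip' (B.krn w v) (B.krn z u)"
proof -
  define h where "h z w = ip (A.krn w v) (A.krn z u) - ip' (B.krn w v) (B.krn z u)" for z w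
  have cnj_h: "cnj (h z w) = ip (A.krn z u) (A.krn w v) - ip' (B.krn z u) (B.krn w v)"
    if "z \<in> S" "w \<in> S" for z w
    using A.ip_cnj[of "A.krn w v" "A.krn z u"] B.ip_cnj[of "B.krn w v" "B.krn z u"] that
    by (simp add: h_def A.krn_in B.krn_in)
  \<comment> \<open>Absolute values make the majorants nonnegative also outside \<open>S\<close>,
    where \<open>krn\<close> is unspecified; summing over \<open>u\<close> and \<open>v\<close> lets
    one function serve both variables.\<close>
  define a where "a z = \<bar>A.nrm (A.krn z u)\<bar> + \<bar>A.nrm (A.krn z v)\<bar>" for z
  define b where "b z = \<bar>B.nrm (B.krn z u)\<bar> + \<bar>B.nrm (B.krn z v)\<bar>" for z
  have ab0: "0 \<le> a z" "0 \<le> b z" for z by (simp_all add: a_def b_def)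
  have "h z w = 0"
  proof (rule polarization[OF S_open S_starlike, where h = h and b = "\<lambda>z. a z + b z"])
    show "lhol S (\<lambda>z. h z w)" if "w \<in> S" for w
      unfolding h_def using that by (intro lhol_diff A.krn_lhol B.krn_lhol)
    show "lhol S (\<lambda>w. cnj (h z w))" if z: "z \<in> S" for z
      using z by (subst lhol_cong[OF cnj_h[OF z]]) (auto intro: lhol_diff A.krn_lhol B.krn_lhol)
    show "h z z = 0" if "z \<in> S" for z using diagonal[OF that] by (simp add: h_def)
    show "0 \<le> a z + b z" for z using ab0 by (simp add: add_nonneg_nonneg)
    show "cmod (h z w) \<le> (a z + b z) * (a w + b w)" if "z \<in> S" "w \<in> S" for z w
    proof -
      have "cmod (h z w) \<le> cmod (ip (A.krn w v) (A.krn z u)) + cmod (ip' (B.krn w v) (B.krn z u))"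
        unfolding h_def by (rule norm_triangle_ineq4)
      also have "\<dots> \<le> A.nrm (A.krn w v) * A.nrm (A.krn z u) + B.nrm (B.krn w v) * B.nrm (B.krn z u)"
        using that by (intro add_mono A.Cauchy_Schwarz B.Cauchy_Schwarz A.krn_in B.krn_in)
      also have "\<dots> \<le> a w * a z + b w * b z"
        using that A.krn_in B.krn_in by (intro add_mono mult_mono) (auto simp: a_def b_def)
      also have "\<dots> \<le> (a z + b z) * (a w + b w)"
        using mult_nonneg_nonneg[OF ab0(1)[of z] ab0(2)[of w]] mult_nonneg_nonneg[OF ab0(2)[of z] ab0(1)[of w]]
        by (simp add: algebra_simps)
      finally show ?thesis .
    qed
    show "\<exists>r>0. \<exists>B. \<forall>w\<in>S \<inter> ball z r. a w + b w \<le> B" if z: "z \<in> S" for z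
    proof -
      obtain r1 B1 where 1: "r1 > 0" "\<And>w. w \<in> S \<inter> ball z r1 \<Longrightarrow> A.nrm (A.krn w u) \<le> B1"
        using A.nrm_krn_bound[OF z] by blast
      obtain r2 B2 where 2: "r2 > 0" "\<And>w. w \<in> S \<inter> ball z r2 \<Longrightarrow> A.nrm (A.krn w v) \<le> B2"
        using A.nrm_krn_bound[OF z] by blast
      obtain r3 B3 where 3: "r3 > 0" "\<And>w. w \<in> S \<inter> ball z r3 \<Longrightarrow> B.nrm (B.krn w u) \<le> B3"
        using B.nrm_krn_bound[OF z] by blast
      obtain r4 B4 where 4: "r4 > 0" "\<And>w. w \<in> S \<inter> ball z r4 \<Longrightarrow> B.nrm (B.krn w v) \<le> B4"
        using B.nrm_krn_bound[OF z] by blast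
      let ?r = "min (min r1 r2) (min r3 r4)"
      have "a w + b w \<le> (B1 + B2) + (B3 + B4)" if w: "w \<in> S \<inter> ball z ?r" for w
      proof -
        have "A.nrm (A.krn w u) \<le> B1" "A.nrm (A.krn w v) \<le> B2" "B.nrm (B.krn w u) \<le> B3"
          "B.nrm (B.krn w v) \<le> B4"
          using w by (auto intro!: 1(2) 2(2) 3(2) 4(2))
        then show ?thesis using A.krn_in[of w] B.krn_in[of w] w by (simp add: a_def b_def)
      qed
      moreover have "?r > 0" using 1(1) 2(1) 3(1) 4(1) by simp
      ultimately show ?thesis by blast
    qed
  qed fact+
  then show ?thesis by (simp add: h_def)
qed

text \<open>The kernel functions at all points are total families, and \<open>kernels_eq\<close>
  makes their Gram matrices coincide. That the unitary respects evaluation is its action on kernel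
  functions, read through the reproducing property.\<close>

theorem unitary_exists:
  "\<exists>U. bij_betw U H H' \<and> (\<forall>F\<in>H. \<forall>z\<in>S. C' z (U F) = C z F) \<and>
       (\<forall>F\<in>H. \<forall>G\<in>H. ip' (U F) (U G) = ip F G)"
proof -
  interpret hilbert_pair sc H ip sc' H' ip' "S \<times> UNIV" "\<lambda>(z, v). A.krn z v" "\<lambda>(z, v). B.krn z v"
  proof unfold_locales
    show "F = 0" if F: "F \<in> H" "\<And>i. i \<in> S \<times> UNIV \<Longrightarrow> ip F (case i of (z, v) \<Rightarrow> A.krn z v) = 0" for F
    proof (rule A.C_total[OF F(1)])
      fix z assume z: "z \<in> S"
      have "cip (C z F) v = cip 0 v" for v using F(2)[of "(z, v)"] z F(1) by (simp add: A.ip_krn)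
      then show "C z F = 0" by (rule cip_eqI)
    qed
    show "F = 0" if F: "F \<in> H'" "\<And>i. i \<in> S \<times> UNIV \<Longrightarrow> ip' F (case i of (z, v) \<Rightarrow> B.krn z v) = 0" for F
    proof (rule B.C_total[OF F(1)])
      fix z assume z: "z \<in> S"
      have "cip (C' z F) v = cip 0 v" for v using F(2)[of "(z, v)"] z F(1) by (simp add: B.ip_krn)
      then show "C' z F = 0" by (rule cip_eqI)
    qed
  qed (auto simp: A.krn_in B.krn_in kernels_eq)
  obtain U where U: "bij_betw U H H'"
    "\<And>F z v. F \<in> H \<Longrightarrow> z \<in> S \<Longrightarrow> ip' (U F) (B.krn z v) = ip F (A.krn z v)"
    "\<And>F G. F \<in> H \<Longrightarrow> G \<in> H \<Longrightarrow> ip' (U F) (U G) = ip F G"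
    using unitary_exists by fastforce
  have "C' z (U F) = C z F" if "F \<in> H" "z \<in> S" for F z
  proof (rule cip_eqI)
    show "cip (C' z (U F)) v = cip (C z F) v" for v
      using U(2)[OF that] that bij_betwE[OF U(1)] by (simp add: A.ip_krn B.ip_krn)
  qed
  then show ?thesis using U(1,3) by blast
qed

end

section \<open>Quasi-free modules\<close>

lemma norm_matrix_vector_le:
  fixes A :: "complex^'m::finite^'k::finite"
  shows "norm (A *v x) \<le> (\<Sum>i\<in>UNIV. \<Sum>j\<in>UNIV. cmod (A $ i $ j)) * norm x"
proof -
  have "norm (A *v x) \<le> (\<Sum>i\<in>UNIV. cmod ((A *v x) $ i))"
    unfolding norm_vec_def by (rule L2_set_le_sum) simp
  also have "\<dots> \<le> (\<Sum>i\<in>UNIV. \<Sum>j\<in>UNIV. cmod (A $ i $ j) * cmod (x $ j))"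
    unfolding matrix_vector_mult_def
    by (intro sum_mono) (auto intro!: order_trans[OF norm_sum] simp: norm_mult)
  also have "\<dots> \<le> (\<Sum>i\<in>UNIV. \<Sum>j\<in>UNIV. cmod (A $ i $ j) * norm x)"
    by (intro sum_mono mult_left_mono Finite_Cartesian_Product.norm_nth_le) auto
  finally show ?thesis by (simp add: sum_distrib_right)
qed

lemma lhol_matrix_locally_bounded:
  fixes A :: "complex^'n::finite \<Rightarrow> complex^'m::finite^'k::finite"
  assumes A: "\<And>i j. lhol S (\<lambda>z. A z $ i $ j)" and z: "z \<in> S"
  shows "\<exists>r>0. \<exists>K\<ge>0. \<forall>w\<in>S \<inter> ball z r. \<forall>x. norm (A w *v x) \<le> K * norm x"
proof -
  let ?m = "\<lambda>w. \<Sum>i\<in>UNIV. \<Sum>j\<in>UNIV. cmod (A w $ i $ j)"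
  have "continuous_on S ?m"
    using A by (intro continuous_on_sum continuous_on_norm) (auto simp: lhol_def)
  then obtain r where r: "r > 0" "\<And>w. w \<in> S \<Longrightarrow> dist w z < r \<Longrightarrow> dist (?m w) (?m z) < 1"
    using z unfolding continuous_on_iff by (metis zero_less_one)
  have "norm (A w *v x) \<le> (?m z + 1) * norm x" if "w \<in> S \<inter> ball z r" for w x
  proof -
    have "?m w \<le> ?m z + 1" using r(2)[of w] that by (simp add: dist_commute[of z] dist_real_def)
    then show ?thesis
      using norm_matrix_vector_le[of "A w" x] by (meson mult_right_mono norm_ge_zero order_trans)
  qed
  moreover have "0 \<le> ?m z + 1" by (simp add: sum_nonneg add_nonneg_nonneg)
  ultimately show ?thesis using r(1) by blast
qed

lemma matrix_inv_mult_vector: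
  fixes A :: "complex^'m::finite^'m"
  assumes "invertible A"
  shows "A *v (matrix_inv A *v x) = x" "matrix_inv A *v (A *v x) = x"
proof -
  have "A ** matrix_inv A = mat 1 \<and> matrix_inv A ** A = mat 1"
    unfolding matrix_inv_def using assms unfolding invertible_def by (rule someI_ex)
  then show "A *v (matrix_inv A *v x) = x" "matrix_inv A *v (A *v x) = x"
    by (simp_all add: matrix_vector_mul_assoc)
qed

section \<open>The function algebra consists of bounded functions and is closed under
  products\<close>

lemma A_algE:
  assumes "\<phi> \<in> A_alg S" "e > 0"
  obtains U g where "open U" "closure S \<subseteq> U" "holo_on U g" "\<And>z. z \<in> S \<Longrightarrow> cmod (\<phi> z - g z) < e"
proof -
  have "\<forall>e>0. \<exists>U g. open U \<and> closure S \<subseteq> U \<and> holo_on U g \<and> (\<forall>z\<in>S. cmod (\<phi> z - g z) < e)"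
    using assms(1) by (simp add: A_alg_def)
  then have "\<exists>U g. open U \<and> closure S \<subseteq> U \<and> holo_on U g \<and> (\<forall>z\<in>S. cmod (\<phi> z - g z) < e)"
    using assms(2) by simp
  then show thesis using that by auto
qed

text \<open>An approximant of \<phi> within 1 is continuous on the closure of \<open>S\<close>,
  which is compact.\<close>

lemma A_alg_bounded:
  assumes "bounded S" "\<phi> \<in> A_alg S"
  shows "\<exists>B. \<forall>z\<in>S. cmod (\<phi> z) \<le> B"
proof -
  obtain U g where g: "open U" "closure S \<subseteq> U" "holo_on U g" "\<And>z. z \<in> S \<Longrightarrow> cmod (\<phi> z - g z) < 1"
    using A_algE[OF assms(2) zero_less_one] by metis
  have "continuous_on (closure S) g"
    using holo_on_imp_lhol[OF g(3)] g(2) unfolding lhol_def by (blast intro: continuous_on_subset)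
  then have "compact (g ` closure S)"
    using assms(1) by (intro compact_continuous_image) (simp_all add: compact_closure)
  then obtain B where "\<forall>x\<in>g ` closure S. cmod x \<le> B"
    using compact_imp_bounded bounded_iff by metis
  then have B: "cmod (g z) \<le> B" if "z \<in> S" for z using that closure_subset by blast
  have "cmod (\<phi> z) \<le> B + 1" if "z \<in> S" for z
    using norm_triangle_sub[of "\<phi> z" "g z"] g(4)[OF that] B[OF that] by linarith
  then show ?thesis by blast
qed

lemma holo_on_mult:
  assumes "holo_on U f" "holo_on V g"
  shows "holo_on (U \<inter> V) (\<lambda>z. f z * g z)"
  unfolding holo_on_def
proof
  fix z assume z: "z \<in> U \<inter> V"
  obtain D where D: "(f has_derivative D) (at z)" "\<And>c v. D (c *s v) = c * D v"
    using assms(1) z unfolding holo_on_def by blast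
  obtain E where E: "(g has_derivative E) (at z)" "\<And>c v. E (c *s v) = c * E v"
    using assms(2) z unfolding holo_on_def by blast
  show "\<exists>D. ((\<lambda>z. f z * g z) has_derivative D) (at z) \<and> (\<forall>c v. D (c *s v) = c * D v)"
    using has_derivative_mult[OF D(1) E(1)]
    by (intro exI[of _ "\<lambda>h. f z * E h + D h * g z"]) (simp add: D(2) E(2) algebra_simps)
qed

lemma A_alg_const: "(\<lambda>z. c) \<in> A_alg S"
proof -
  have "holo_on UNIV (\<lambda>z. c)"
    unfolding holo_on_def by (auto intro!: exI[of _ "\<lambda>v. 0"])
  then show ?thesis
    unfolding A_alg_def by (intro CollectI allI impI exI[of _ UNIV] exI[of _ "\<lambda>z. c"]) simp
qed

lemma A_alg_mult:
  assumes S: "bounded S" and \<phi>: "\<phi> \<in> A_alg S" and \<psi>: "\<psi> \<in> A_alg S"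
  shows "(\<lambda>z. \<phi> z * \<psi> z) \<in> A_alg S"
  unfolding A_alg_def
proof (intro CollectI allI impI)
  fix e :: real assume e: "e > 0"
  obtain B1 where B1: "\<And>z. z \<in> S \<Longrightarrow> cmod (\<phi> z) \<le> B1" using A_alg_bounded[OF S \<phi>] by blast
  obtain B2 where B2: "\<And>z. z \<in> S \<Longrightarrow> cmod (\<psi> z) \<le> B2" using A_alg_bounded[OF S \<psi>] by blast
  define M where "M = \<bar>B1\<bar> + \<bar>B2\<bar> + 1"
  \<comment> \<open>The cap 1 keeps the approximant \<open>g\<close> bounded by \<open>M\<close>;
    the other term splits \<open>e\<close> evenly between the two summands of the product
    estimate.\<close>
  define d where "d = min 1 (e / (2 * M))"
  have M: "M > 0" by (simp add: M_def add_nonneg_pos)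
  then have d: "d > 0" "d \<le> 1" "d \<le> e / (2 * M)" using e by (simp_all add: d_def)
  obtain U g where g: "open U" "closure S \<subseteq> U" "holo_on U g" "\<And>z. z \<in> S \<Longrightarrow> cmod (\<phi> z - g z) < d"
    using A_algE[OF \<phi> d(1)] by metis
  obtain V h where h: "open V" "closure S \<subseteq> V" "holo_on V h" "\<And>z. z \<in> S \<Longrightarrow> cmod (\<psi> z - h z) < d"
    using A_algE[OF \<psi> d(1)] by metis
  have "cmod (\<phi> z * \<psi> z - g z * h z) < e" if z: "z \<in> S" for z
  proof -
    have "cmod (g z) \<le> B1 + 1"
      using norm_triangle_sub[of "g z" "\<phi> z"] g(4)[OF z] B1[OF z] d(2) by (simp add: norm_minus_commute)
    then have gM: "cmod (g z) \<le> M" by (simp add: M_def)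
    have \<psi>M: "cmod (\<psi> z) \<le> M" using B2[OF z] by (simp add: M_def)
    have "\<phi> z * \<psi> z - g z * h z = (\<phi> z - g z) * \<psi> z + g z * (\<psi> z - h z)" by (simp add: algebra_simps)
    then have "cmod (\<phi> z * \<psi> z - g z * h z) \<le> cmod (\<phi> z - g z) * cmod (\<psi> z) + cmod (g z) * cmod (\<psi> z - h z)"
      by (metis norm_mult norm_triangle_ineq)
    also have "\<dots> \<le> cmod (\<phi> z - g z) * M + M * cmod (\<psi> z - h z)"
      using gM \<psi>M by (intro add_mono mult_left_mono mult_right_mono) auto
    also have "\<dots> < d * M + M * d"
      using g(4)[OF z] h(4)[OF z] M by (intro add_strict_mono mult_strict_left_mono mult_strict_right_mono)
    also have "\<dots> \<le> e" using d(3) M by (simp add: field_simps)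
    finally show ?thesis .
  qed
  then show "\<exists>U k. open U \<and> closure S \<subseteq> U \<and> holo_on U k \<and> (\<forall>z\<in>S. cmod (\<phi> z * \<psi> z - k z) < e)"
    using g h holo_on_mult[OF g(3) h(3)]
    by (intro exI[of _ "U \<inter> V"] exI[of _ "\<lambda>z. g z * h z"]) auto
qed

section \<open>Spans of functions and the algebraic tensor product\<close>

definition fsc :: "complex \<Rightarrow> ('a \<Rightarrow> complex^'m) \<Rightarrow> 'a \<Rightarrow> complex^'m" where
  "fsc c F = (\<lambda>w. c *s F w)"

lemma fsc_vector_space: "vector_space fsc"
  by unfold_locales (auto simp: fsc_def fun_eq_iff vector_add_ldistrib vector_sadd_rdistrib)

lemma cspan_superset: "F \<in> X \<Longrightarrow> F \<in> cspan X"
  unfolding cspan_def by (intro CollectI exI[of _ 1] exI[of _ "\<lambda>_. 1"] exI[of _ "\<lambda>_. F"]) simp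

lemma cspan_zero: "0 \<in> cspan X"
  unfolding cspan_def by (intro CollectI exI[of _ 0]) (simp add: zero_fun_def)

lemma cspan_scale: "F \<in> cspan X \<Longrightarrow> fsc c F \<in> cspan X"
proof -
  assume "F \<in> cspan X"
  then obtain k :: nat and a h where *: "\<forall>i<k. h i \<in> X" "F = (\<lambda>w. \<Sum>i<k. a i *s h i w)"
    unfolding cspan_def mem_Collect_eq by (elim exE conjE) (rule that)
  then show ?thesis
    unfolding cspan_def
    by (intro CollectI exI[of _ k] exI[of _ "\<lambda>i. c * a i"] exI[of _ h])
      (simp add: fsc_def vec.scale_sum_right)
qed

lemma cspan_add: "F \<in> cspan X \<Longrightarrow> G \<in> cspan X \<Longrightarrow> F + G \<in> cspan X"
proof -
  assume F: "F \<in> cspan X" and G: "G \<in> cspan X"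
  obtain k :: nat and a h where 1: "\<forall>i<k. h i \<in> X" "F = (\<lambda>w. \<Sum>i<k. a i *s h i w)"
    using F unfolding cspan_def mem_Collect_eq by (elim exE conjE) (rule that)
  obtain l :: nat and b h' where 2: "\<forall>i<l. h' i \<in> X" "G = (\<lambda>w. \<Sum>i<l. b i *s h' i w)"
    using G unfolding cspan_def mem_Collect_eq by (elim exE conjE) (rule that)
  let ?c = "\<lambda>i::nat. if i < k then a i else b (i - k)"
  let ?h = "\<lambda>i::nat. if i < k then h i else h' (i - k)"
  have "(\<Sum>i<k+l. ?c i *s ?h i w) = F w + G w" for w
  proof -
    have "(\<Sum>i<k+l. ?c i *s ?h i w) = (\<Sum>i<k. ?c i *s ?h i w) + (\<Sum>i<l. ?c (k + i) *s ?h (k + i) w)"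
      by (induction l) (simp_all add: add.assoc)
    then show ?thesis by (simp add: 1 2)
  qed
  then show ?thesis
    using 1(1) 2(1) unfolding cspan_def
    by (intro CollectI exI[of _ "k + l"] exI[of _ ?c] exI[of _ ?h]) (auto simp: fun_eq_iff)
qed

lemma cspan_minimal:
  assumes "X \<subseteq> T" "0 \<in> T" "\<And>F G. F \<in> T \<Longrightarrow> G \<in> T \<Longrightarrow> F + G \<in> T" "\<And>c F. F \<in> T \<Longrightarrow> fsc c F \<in> T"
  shows "cspan X \<subseteq> T"
proof
  fix F assume "F \<in> cspan X"
  then obtain k :: nat and a h where *: "\<forall>i<k. h i \<in> X" "F = (\<lambda>w. \<Sum>i<k. a i *s h i w)"
    unfolding cspan_def mem_Collect_eq by (elim exE conjE) (rule that)
  have "(\<lambda>w. \<Sum>i<j. a i *s h i w) \<in> T" if "j \<le> k" for j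
    using that
  proof (induction j)
    case 0
    then show ?case using assms(2) by (simp add: zero_fun_def)
  next
    case (Suc j)
    then have "(\<lambda>w. \<Sum>i<j. a i *s h i w) + fsc (a j) (h j) \<in> T"
      using assms(1) * by (intro assms(3,4)) auto
    then show ?case by (simp add: fsc_def plus_fun_def)
  qed
  then show "F \<in> T" using * by simp
qed

lemma alg_tensor_const: "(\<lambda>z. if z \<in> S then v else 0) \<in> alg_tensor S"
  unfolding alg_tensor_def
proof (rule cspan_superset)
  have "(\<lambda>z. 1) \<in> A_alg S \<and> (\<lambda>z. if z \<in> S then v else 0) = (\<lambda>z. if z \<in> S then 1 *s v else 0)"
    by (simp add: A_alg_const cong: if_cong)
  then show "(\<lambda>z. if z \<in> S then v else 0) \<in>
      {F. \<exists>\<phi> v. \<phi> \<in> A_alg S \<and> F = (\<lambda>z. if z \<in> S then \<phi> z *s v else 0)}"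
    by blast
qed

text \<open>The functions whose product with \<phi> stays in the span form a subspace, so only
  generators matter, and for these \<open>A_alg_mult\<close> applies.\<close>

lemma alg_tensor_mult:
  fixes F :: "complex^'n::finite \<Rightarrow> complex^'m::finite"
  assumes S: "bounded S" and \<phi>: "\<phi> \<in> A_alg S" and F: "F \<in> alg_tensor S"
  shows "(\<lambda>z. \<phi> z *s F z) \<in> alg_tensor S"
proof -
  let ?G = "{F :: complex^'n \<Rightarrow> complex^'m. \<exists>\<phi> v. \<phi> \<in> A_alg S \<and> F = (\<lambda>z. if z \<in> S then \<phi> z *s v else 0)}"
  let ?T = "{F :: complex^'n \<Rightarrow> complex^'m. (\<lambda>z. \<phi> z *s F z) \<in> cspan ?G}"
  have "cspan ?G \<subseteq> ?T"
  proof (rule cspan_minimal)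
    show "?G \<subseteq> ?T"
    proof
      fix F assume "F \<in> ?G"
      then obtain \<psi> v where \<psi>: "\<psi> \<in> A_alg S" "F = (\<lambda>z. if z \<in> S then \<psi> z *s v else 0)" by blast
      have "(\<lambda>z. \<phi> z *s F z) = (\<lambda>z. if z \<in> S then (\<phi> z * \<psi> z) *s v else 0)"
        by (auto simp: \<psi>(2))
      then have "(\<lambda>z. \<phi> z *s F z) \<in> ?G" using A_alg_mult[OF S \<phi> \<psi>(1)] by blast
      then have "(\<lambda>z. \<phi> z *s F z) \<in> cspan ?G" by (rule cspan_superset)
      then show "F \<in> ?T" by (simp only: mem_Collect_eq)
    qed
    show "0 \<in> ?T" using cspan_zero[of ?G] by (simp add: zero_fun_def)
    show "F + G \<in> ?T" if "F \<in> ?T" "G \<in> ?T" for F G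
    proof -
      have "(\<lambda>z. \<phi> z *s F z) + (\<lambda>z. \<phi> z *s G z) \<in> cspan ?G" using that by (intro cspan_add) simp_all
      then show ?thesis by (simp add: plus_fun_def vector_add_ldistrib)
    qed
    show "fsc c F \<in> ?T" if "F \<in> ?T" for c F
    proof -
      have "fsc c (\<lambda>z. \<phi> z *s F z) \<in> cspan ?G" using that by (intro cspan_scale) simp
      then show ?thesis by (simp add: fsc_def mult.commute)
    qed
  qed
  then have "F \<in> ?T" using F unfolding alg_tensor_def by (rule subsetD)
  then show ?thesis unfolding alg_tensor_def by (rule CollectD)
qed

lemma norm_bound_null:
  fixes f :: "nat \<Rightarrow> 'a::real_normed_vector"
  assumes "\<And>k. norm (f k) \<le> g k" "g \<longlonglongrightarrow> 0"
  shows "f \<longlonglongrightarrow> 0"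
  by (rule Lim_null_comparison[OF _ assms(2)]) (simp add: assms(1))

section \<open>Evaluation on the completion\<close>

locale quasi_free_module =
  fixes S :: "(complex^'n::finite) set" and R :: "(complex^'n \<Rightarrow> complex^'m::finite) set"
    and ip :: "(complex^'n \<Rightarrow> complex^'m) \<Rightarrow> (complex^'n \<Rightarrow> complex^'m) \<Rightarrow> complex"
  assumes bounded_S: "bounded S" and open_S: "open S" and qf: "quasi_free S R ip"
begin

lemma R_holo: "F \<in> R \<Longrightarrow> holo_vec S F"
  and R_zero: "0 \<in> R"
  and R_add: "F \<in> R \<Longrightarrow> G \<in> R \<Longrightarrow> F + G \<in> R"
  and R_scale: "F \<in> R \<Longrightarrow> fsc c F \<in> R"
  and R_ip_add: "F \<in> R \<Longrightarrow> G \<in> R \<Longrightarrow> K \<in> R \<Longrightarrow> ip (F + G) K = ip F K + ip G K"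
  and R_ip_scale: "F \<in> R \<Longrightarrow> K \<in> R \<Longrightarrow> ip (fsc c F) K = c * ip F K"
  and R_ip_cnj: "F \<in> R \<Longrightarrow> K \<in> R \<Longrightarrow> ip K F = cnj (ip F K)"
  and R_ip_ge_0: "F \<in> R \<Longrightarrow> 0 \<le> Re (ip F F)"
  and R_ip_eq_0: "F \<in> R \<Longrightarrow> ip F F = 0 \<Longrightarrow> F = 0"
  and R_complete: "(\<And>k. X k \<in> R) \<Longrightarrow> rcauchy ip X \<Longrightarrow> \<exists>F\<in>R. (\<lambda>k. rnorm ip (\<lambda>w. X k w - F w)) \<longlonglongrightarrow> 0"
  and alg_tensor_subset: "alg_tensor S \<subseteq> R"
  and alg_tensor_dense: "F \<in> R \<Longrightarrow> e > 0 \<Longrightarrow> \<exists>K\<in>alg_tensor S. rnorm ip (\<lambda>w. F w - K w) < e"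
  and eval_bound: "z \<in> S \<Longrightarrow> \<exists>r>0. \<exists>B. \<forall>w\<in>S \<inter> ball z r. \<forall>F\<in>alg_tensor S. norm (F w) \<le> B * rnorm ip F"
  and R_mult: "\<phi> \<in> A_alg S \<Longrightarrow> F \<in> R \<Longrightarrow> (\<lambda>z. \<phi> z *s F z) \<in> R"
  and R_mult_bound: "\<phi> \<in> A_alg S \<Longrightarrow> F \<in> R \<Longrightarrow> rnorm ip (\<lambda>z. \<phi> z *s F z) \<le> supnorm S \<phi> * rnorm ip F"
  and alg_tensor_null: "(\<And>k. X k \<in> alg_tensor S) \<Longrightarrow> rcauchy ip X \<Longrightarrow>
    (\<And>z. z \<in> S \<Longrightarrow> (\<lambda>k. X k z) \<longlonglongrightarrow> 0) \<Longrightarrow> (\<lambda>k. rnorm ip (X k)) \<longlonglongrightarrow> 0"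
proof -
  from qf have
    1: "\<forall>F\<in>R. (\<forall>z. z \<notin> S \<longrightarrow> F z = 0) \<and> holo_vec S F" and
    2: "(\<lambda>z. 0) \<in> R" and
    3: "\<forall>F\<in>R. \<forall>G\<in>R. (\<lambda>z. F z + G z) \<in> R" and
    4: "\<forall>F\<in>R. \<forall>c. (\<lambda>z. c *s F z) \<in> R" and
    5: "\<forall>F\<in>R. \<forall>G\<in>R. \<forall>H\<in>R. ip (\<lambda>z. F z + G z) H = ip F H + ip G H" and
    6: "\<forall>F\<in>R. \<forall>H\<in>R. \<forall>c. ip (\<lambda>z. c *s F z) H = c * ip F H" and
    7: "\<forall>F\<in>R. \<forall>H\<in>R. ip H F = cnj (ip F H)" and
    8: "\<forall>F\<in>R. Re (ip F F) \<ge> 0" and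
    9: "\<forall>F\<in>R. ip F F = 0 \<longrightarrow> F = (\<lambda>z. 0)" and
    10: "\<forall>X. (\<forall>k. X k \<in> R) \<and> rcauchy ip X \<longrightarrow> (\<exists>F\<in>R. (\<lambda>k. rnorm ip (\<lambda>w. X k w - F w)) \<longlonglongrightarrow> 0)" and
    11: "alg_tensor S \<subseteq> R" and
    12: "\<forall>F\<in>R. \<forall>\<epsilon>>0. \<exists>H\<in>alg_tensor S. rnorm ip (\<lambda>w. F w - H w) < \<epsilon>" and
    13: "\<forall>z\<in>S. \<exists>r>0. \<exists>C. \<forall>w\<in>S \<inter> ball z r. \<forall>F\<in>alg_tensor S. norm (F w) \<le> C * rnorm ip F" and
    14: "\<forall>\<phi>\<in>A_alg S. \<forall>F\<in>R. (\<lambda>z. \<phi> z *s F z) \<in> R \<and>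
          rnorm ip (\<lambda>z. \<phi> z *s F z) \<le> supnorm S \<phi> * rnorm ip F" and
    15: "\<forall>X. (\<forall>k. X k \<in> alg_tensor S) \<and> rcauchy ip X \<longrightarrow>
          ((\<forall>z\<in>S. (\<lambda>k. X k z) \<longlonglongrightarrow> 0) \<longleftrightarrow> (\<lambda>k. rnorm ip (X k)) \<longlonglongrightarrow> 0)"
    unfolding quasi_free_def by - (elim conjE, assumption)+
  show "F \<in> R \<Longrightarrow> holo_vec S F" using 1 by simp
  show "0 \<in> R" using 2 by (simp add: zero_fun_def)
  show "F \<in> R \<Longrightarrow> G \<in> R \<Longrightarrow> F + G \<in> R" using 3 by (simp add: plus_fun_def)
  show "F \<in> R \<Longrightarrow> fsc c F \<in> R" using 4 by (simp add: fsc_def)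
  show "F \<in> R \<Longrightarrow> G \<in> R \<Longrightarrow> K \<in> R \<Longrightarrow> ip (F + G) K = ip F K + ip G K"
    using 5 by (simp add: plus_fun_def)
  show "F \<in> R \<Longrightarrow> K \<in> R \<Longrightarrow> ip (fsc c F) K = c * ip F K" using 6 by (simp add: fsc_def)
  show "F \<in> R \<Longrightarrow> K \<in> R \<Longrightarrow> ip K F = cnj (ip F K)" using 7 by blast
  show "F \<in> R \<Longrightarrow> 0 \<le> Re (ip F F)" using 8 by (rule bspec)
  show "F \<in> R \<Longrightarrow> ip F F = 0 \<Longrightarrow> F = 0" using 9 by (simp add: zero_fun_def)
  show "(\<And>k. X k \<in> R) \<Longrightarrow> rcauchy ip X \<Longrightarrow> \<exists>F\<in>R. (\<lambda>k. rnorm ip (\<lambda>w. X k w - F w)) \<longlonglongrightarrow> 0"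
    using spec[OF 10, of X] by simp
  show "alg_tensor S \<subseteq> R" by (rule 11)
  show "F \<in> R \<Longrightarrow> e > 0 \<Longrightarrow> \<exists>K\<in>alg_tensor S. rnorm ip (\<lambda>w. F w - K w) < e" using 12 by simp
  show "z \<in> S \<Longrightarrow> \<exists>r>0. \<exists>B. \<forall>w\<in>S \<inter> ball z r. \<forall>F\<in>alg_tensor S. norm (F w) \<le> B * rnorm ip F"
    using 13 by (rule bspec)
  show "\<phi> \<in> A_alg S \<Longrightarrow> F \<in> R \<Longrightarrow> (\<lambda>z. \<phi> z *s F z) \<in> R"
    "\<phi> \<in> A_alg S \<Longrightarrow> F \<in> R \<Longrightarrow> rnorm ip (\<lambda>z. \<phi> z *s F z) \<le> supnorm S \<phi> * rnorm ip F"
    using 14 by simp_all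
  show "(\<And>k. X k \<in> alg_tensor S) \<Longrightarrow> rcauchy ip X \<Longrightarrow>
    (\<And>z. z \<in> S \<Longrightarrow> (\<lambda>k. X k z) \<longlonglongrightarrow> 0) \<Longrightarrow> (\<lambda>k. rnorm ip (X k)) \<longlonglongrightarrow> 0"
    using spec[OF 15, of X] by simp
qed

sublocale hilbert_carrier fsc R ip
proof (intro hilbert_carrier.intro fsc_vector_space hilbert_carrier_axioms.intro)
  fix X :: "nat \<Rightarrow> complex^'n \<Rightarrow> complex^'m"
  assume X: "\<And>k. X k \<in> R"
    "\<And>e. e > 0 \<Longrightarrow> \<exists>N. \<forall>k\<ge>N. \<forall>l\<ge>N. sqrt (Re (ip (X k - X l) (X k - X l))) < e"
  have "rcauchy ip X"
    using X(2) unfolding rcauchy_def rnorm_def fun_diff_def by blast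
  from R_complete[OF X(1) this]
  show "\<exists>F\<in>R. (\<lambda>k. sqrt (Re (ip (X k - F) (X k - F)))) \<longlonglongrightarrow> 0"
    unfolding rnorm_def fun_diff_def .
qed (fact R_zero R_add R_scale R_ip_add R_ip_scale R_ip_cnj R_ip_ge_0 R_ip_eq_0 | assumption)+

lemma rnorm_eq: "rnorm ip F = nrm F"
  by (simp add: rnorm_def nrm_def)

lemma rnorm_diff_eq: "rnorm ip (\<lambda>w. F w - G w) = nrm (F - G)"
  by (simp add: rnorm_def nrm_def fun_diff_def)

lemma alg_in: "K \<in> alg_tensor S \<Longrightarrow> K \<in> R"
  using alg_tensor_subset by blast

lemma alg_diff:
  fixes F G :: "complex^'n \<Rightarrow> complex^'m"
  shows "F \<in> alg_tensor S \<Longrightarrow> G \<in> alg_tensor S \<Longrightarrow> F - G \<in> alg_tensor S"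
proof -
  assume "F \<in> alg_tensor S" "G \<in> alg_tensor S"
  then have "F + fsc (- 1) G \<in> alg_tensor S" unfolding alg_tensor_def by (intro cspan_add cspan_scale)
  then show ?thesis by simp
qed

definition approx :: "(complex^'n \<Rightarrow> complex^'m) \<Rightarrow> nat \<Rightarrow> complex^'n \<Rightarrow> complex^'m" where
  "approx F k = (SOME K. K \<in> alg_tensor S \<and> nrm (F - K) < 1 / real (Suc k))"

lemma approx:
  assumes "F \<in> R"
  shows "approx F k \<in> alg_tensor S" "nrm (F - approx F k) < 1 / real (Suc k)"
proof -
  have "\<exists>K. K \<in> alg_tensor S \<and> nrm (F - K) < 1 / real (Suc k)"
    using alg_tensor_dense[OF assms, of "1 / real (Suc k)"] unfolding rnorm_diff_eq by auto
  from someI_ex[OF this]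
  show "approx F k \<in> alg_tensor S" "nrm (F - approx F k) < 1 / real (Suc k)"
    unfolding approx_def by blast+
qed

lemma approx_lim: "F \<in> R \<Longrightarrow> (\<lambda>k. nrm (F - approx F k)) \<longlonglongrightarrow> 0"
proof (rule tendsto_sandwich[of "\<lambda>_. 0" _ _ "\<lambda>k. 1 / real (Suc k)"])
  show "(\<lambda>k. 1 / real (Suc k)) \<longlonglongrightarrow> 0"
    using LIMSEQ_inverse_real_of_nat by (simp add: inverse_eq_divide)
qed (auto intro!: always_eventually less_imp_le approx(2) simp: diff_in alg_in approx(1) simp del: of_nat_Suc)

text \<open>It is not assumed that evaluation at a point is continuous on all of \<open>R\<close>; \<open>ev z F\<close> is the
  value at \<open>z\<close> of the element \<open>F\<close> of the completion, i.e. the continuous extension of evaluation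
  from \<open>alg_tensor S\<close>.\<close>

definition ev :: "complex^'n \<Rightarrow> (complex^'n \<Rightarrow> complex^'m) \<Rightarrow> complex^'m" where
  "ev z F = lim (\<lambda>k. approx F k z)"

text \<open>One estimate serves twice: \<open>K = 0\<close> gives bounded evaluation on
  \<open>R\<close>, and approximants as \<open>K\<close> give locally uniform convergence. It is the
  limit of the bound on \<open>alg_tensor S\<close>, whose constant is uniform near
  \<open>z\<close>.\<close>

lemma ev_bound:
  assumes z: "z \<in> S"
  shows "\<exists>r>0. \<exists>B\<ge>0. \<forall>w\<in>S \<inter> ball z r. \<forall>F\<in>R. \<forall>K\<in>alg_tensor S. norm (ev w F - K w) \<le> B * nrm (F - K)"
proof -
  obtain r B0 where r: "r > 0"
    and B0: "\<And>w F. w \<in> S \<inter> ball z r \<Longrightarrow> F \<in> alg_tensor S \<Longrightarrow> norm (F w) \<le> B0 * nrm F"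
    using eval_bound[OF z] unfolding rnorm_eq by blast
  define B where "B = \<bar>B0\<bar>"
  have "B \<ge> 0" by (simp add: B_def)
  have B: "norm (F w - G w) \<le> B * nrm (F - G)"
    if "w \<in> S \<inter> ball z r" "F \<in> alg_tensor S" "G \<in> alg_tensor S" for w F G
  proof -
    have "norm (F w - G w) \<le> B0 * nrm (F - G)"
      using B0[OF that(1) alg_diff[OF that(2,3)]] by (simp add: fun_diff_def)
    also have "\<dots> \<le> B * nrm (F - G)"
      unfolding B_def using that by (intro mult_right_mono) (auto simp: diff_in alg_in)
    finally show ?thesis .
  qed
  have "norm (ev w F - K w) \<le> B * nrm (F - K)"
    if w: "w \<in> S \<inter> ball z r" and F: "F \<in> R" and K: "K \<in> alg_tensor S" for w F K
  proof -
    let ?X = "approx F"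
    have X: "?X k \<in> alg_tensor S" "?X k \<in> R" for k using approx(1)[OF F] alg_in by auto
    have le: "nrm (?X k - L) \<le> nrm (F - ?X k) + nrm (F - L)" if "L \<in> R" for k L
      using nrm_triangle_diff[OF X(2) F that] nrm_minus_commute[OF F X(2)] by simp
    have "Cauchy (\<lambda>k. ?X k w)"
      unfolding Cauchy_def
    proof (intro allI impI)
      fix e :: real assume e: "e > 0"
      \<comment> \<open>The denominator uses \<open>B + 1\<close> because \<open>B\<close> may be
        0.\<close>
      have "0 < e / (2 * (B + 1))" using e \<open>B \<ge> 0\<close> by simp
      from order_tendstoD(2)[OF approx_lim[OF F] this]
      obtain N where N: "\<And>k. k \<ge> N \<Longrightarrow> nrm (F - ?X k) < e / (2 * (B + 1))"
        unfolding eventually_sequentially by blast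
      have "dist (?X k w) (?X l w) < e" if kl: "k \<ge> N" "l \<ge> N" for k l
      proof -
        have "dist (?X k w) (?X l w) \<le> B * nrm (?X k - ?X l)"
          unfolding dist_norm using w X by (intro B)
        also have "\<dots> \<le> (B + 1) * (nrm (F - ?X k) + nrm (F - ?X l))"
          using le[OF X(2)] \<open>B \<ge> 0\<close> X(2) F by (intro mult_mono) (auto simp: diff_in)
        also have "\<dots> < (B + 1) * (e / (2 * (B + 1)) + e / (2 * (B + 1)))"
          using N[OF kl(1)] N[OF kl(2)] \<open>B \<ge> 0\<close> by (intro mult_strict_left_mono add_strict_mono) auto
        also have "\<dots> = e"
        proof -
          have *: "x * (e / (2 * x) + e / (2 * x)) = e" if "x > 0" for x :: real
            using that by (simp add: field_simps)
          show ?thesis by (rule *) (use \<open>B \<ge> 0\<close> in simp)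
        qed
        finally show ?thesis .
      qed
      then show "\<exists>N. \<forall>k\<ge>N. \<forall>l\<ge>N. dist (?X k w) (?X l w) < e" by blast
    qed
    then have lim: "(\<lambda>k. ?X k w) \<longlonglongrightarrow> ev w F"
      unfolding ev_def by (simp add: Cauchy_convergent_iff convergent_LIMSEQ_iff)
    show ?thesis
    proof (rule LIMSEQ_le)
      show "(\<lambda>k. norm (?X k w - K w)) \<longlonglongrightarrow> norm (ev w F - K w)"
        using lim by (intro tendsto_intros)
      show "(\<lambda>k. B * (nrm (F - ?X k) + nrm (F - K))) \<longlonglongrightarrow> B * nrm (F - K)"
        using tendsto_mult[OF tendsto_const[of B] tendsto_add[OF approx_lim[OF F] tendsto_const[of "nrm (F - K)"]]]
        by simp
      have "norm (?X k w - K w) \<le> B * (nrm (F - ?X k) + nrm (F - K))" for k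
        using order_trans[OF B[OF w X(1) K] mult_left_mono[OF le[OF alg_in[OF K]] \<open>B \<ge> 0\<close>]] .
      then show "\<exists>N. \<forall>k\<ge>N. norm (?X k w - K w) \<le> B * (nrm (F - ?X k) + nrm (F - K))" by blast
    qed
  qed
  then show ?thesis using r \<open>B \<ge> 0\<close> by blast
qed

lemma alg_zero: "(0 :: complex^'n \<Rightarrow> complex^'m) \<in> alg_tensor S"
  by (simp add: alg_tensor_def cspan_zero)

lemma ev_norm_le:
  assumes z: "z \<in> S"
  shows "\<exists>r>0. \<exists>B\<ge>0. \<forall>w\<in>S \<inter> ball z r. \<forall>F\<in>R. norm (ev w F) \<le> B * nrm F"
proof -
  obtain r B where "r > 0" "B \<ge> 0"
    "\<And>w F K. w \<in> S \<inter> ball z r \<Longrightarrow> F \<in> R \<Longrightarrow> K \<in> alg_tensor S \<Longrightarrow> norm (ev w F - K w) \<le> B * nrm (F - K)"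
    using ev_bound[OF z] by metis
  moreover from this(3)[OF _ _ alg_zero]
  have "norm (ev w F) \<le> B * nrm F" if "w \<in> S \<inter> ball z r" "F \<in> R" for w F using that by simp
  ultimately show ?thesis by blast
qed

text \<open>The value is independent of the approximating sequence, so sums and products may be
  evaluated along sums and products of chosen approximants.\<close>

lemma ev_lim:
  assumes z: "z \<in> S" and F: "F \<in> R" and Y: "\<And>k. Y k \<in> alg_tensor S"
    and lim: "(\<lambda>k. nrm (F - Y k)) \<longlonglongrightarrow> 0"
  shows "(\<lambda>k. Y k z) \<longlonglongrightarrow> ev z F"
proof -
  obtain r B where r: "r > 0" "B \<ge> 0"
    "\<And>w F K. w \<in> S \<inter> ball z r \<Longrightarrow> F \<in> R \<Longrightarrow> K \<in> alg_tensor S \<Longrightarrow> norm (ev w F - K w) \<le> B * nrm (F - K)"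
    using ev_bound[OF z] by metis
  have "norm (Y k z - ev z F) \<le> B * nrm (F - Y k)" for k
    using r(3)[of z F "Y k"] z r(1) F Y by (simp add: norm_minus_commute)
  moreover have "(\<lambda>k. B * nrm (F - Y k)) \<longlonglongrightarrow> 0"
    using tendsto_mult[OF tendsto_const lim, of B] by simp
  ultimately have "(\<lambda>k. Y k z - ev z F) \<longlonglongrightarrow> 0"
    by (rule norm_bound_null)
  then show ?thesis by (rule LIM_zero_cancel)
qed

lemma ev_alg: "z \<in> S \<Longrightarrow> K \<in> alg_tensor S \<Longrightarrow> ev z K = K z"
  using LIMSEQ_unique[OF ev_lim[of z K "\<lambda>_. K"] tendsto_const] alg_in by simp

lemma ev_add:
  assumes z: "z \<in> S" and F: "F \<in> R" and G: "G \<in> R"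
  shows "ev z (F + G) = ev z F + ev z G"
proof (rule LIMSEQ_unique)
  have X: "approx F k \<in> R" "approx G k \<in> R" for k using approx(1) F G alg_in by auto
  show "(\<lambda>k. (approx F k + approx G k) z) \<longlonglongrightarrow> ev z (F + G)"
  proof (rule ev_lim[OF z R_add[OF F G]])
    show "approx F k + approx G k \<in> alg_tensor S" for k
      using approx(1)[OF F, of k] approx(1)[OF G, of k] unfolding alg_tensor_def by (rule cspan_add)
    have "norm (nrm (F + G - (approx F k + approx G k))) \<le> nrm (F - approx F k) + nrm (G - approx G k)" for k
      using nrm_triangle[of "F - approx F k" "G - approx G k"] F G X
      by (simp add: carrier_intros algebra_simps)
    then show "(\<lambda>k. nrm (F + G - (approx F k + approx G k))) \<longlonglongrightarrow> 0"
      by (rule norm_bound_null) (use tendsto_add[OF approx_lim[OF F] approx_lim[OF G]] in simp)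
  qed
  show "(\<lambda>k. (approx F k + approx G k) z) \<longlonglongrightarrow> ev z F + ev z G"
    using tendsto_add[OF ev_lim[OF z F approx(1)[OF F] approx_lim[OF F]]
        ev_lim[OF z G approx(1)[OF G] approx_lim[OF G]]] by simp
qed

text \<open>Multiplication by \<phi> keeps the approximants in \<open>alg_tensor S\<close> and,
  being bounded on \<open>R\<close>, preserves their convergence.\<close>

lemma ev_mult:
  assumes z: "z \<in> S" and \<phi>: "\<phi> \<in> A_alg S" and F: "F \<in> R"
  shows "ev z (\<lambda>w. \<phi> w *s F w) = \<phi> z *s ev z F"
proof (rule LIMSEQ_unique)
  have X: "approx F k \<in> R" for k using approx(1) F alg_in by auto
  show "(\<lambda>k. \<phi> z *s approx F k z) \<longlonglongrightarrow> ev z (\<lambda>w. \<phi> w *s F w)"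
  proof (rule ev_lim[OF z R_mult[OF \<phi> F], of "\<lambda>k w. \<phi> w *s approx F k w"])
    show "(\<lambda>w. \<phi> w *s approx F k w) \<in> alg_tensor S" for k
      using alg_tensor_mult[OF bounded_S \<phi>] approx(1)[OF F] by blast
    have "norm (nrm ((\<lambda>w. \<phi> w *s F w) - (\<lambda>w. \<phi> w *s approx F k w))) \<le> supnorm S \<phi> * nrm (F - approx F k)" for k
    proof -
      have D: "F - approx F k \<in> R" using F X by (rule diff_in)
      have "(\<lambda>w. \<phi> w *s F w) - (\<lambda>w. \<phi> w *s approx F k w) = (\<lambda>w. \<phi> w *s (F - approx F k) w)"
        by (simp add: fun_diff_def vec.scale_right_diff_distrib)
      then show ?thesis
        using R_mult_bound[OF \<phi> D] R_mult[OF \<phi> D] by (simp only: rnorm_eq) simp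
    qed
    then show "(\<lambda>k. nrm ((\<lambda>w. \<phi> w *s F w) - (\<lambda>w. \<phi> w *s approx F k w))) \<longlonglongrightarrow> 0"
      by (rule norm_bound_null) (use tendsto_mult[OF tendsto_const approx_lim[OF F], of "supnorm S \<phi>"] in simp)
  qed
  have "(\<lambda>k. \<chi> i. \<phi> z * approx F k z $ i) \<longlonglongrightarrow> (\<chi> i. \<phi> z * ev z F $ i)"
    using ev_lim[OF z F approx(1)[OF F] approx_lim[OF F]] by (intro tendsto_intros)
  then show "(\<lambda>k. \<phi> z *s approx F k z) \<longlonglongrightarrow> \<phi> z *s ev z F"
    by (simp add: vector_scalar_mult_def)
qed

lemma ev_scale: "z \<in> S \<Longrightarrow> F \<in> R \<Longrightarrow> ev z (fsc c F) = c *s ev z F"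
  using ev_mult[OF _ A_alg_const, of z F c] by (simp add: fsc_def)

text \<open>The approximants are holomorphic and, by \<open>ev_bound\<close>, converge locally
  uniformly.\<close>

lemma ev_lhol:
  assumes F: "F \<in> R"
  shows "lhol S (\<lambda>z. ev z F $ i)"
proof (rule lhol_uniform_limit[OF open_S])
  show "lhol S (\<lambda>z. approx F k z $ i)" for k
    using R_holo[OF alg_in[OF approx(1)[OF F]]] by (simp add: holo_vec_def holo_on_imp_lhol)
  fix z assume z: "z \<in> S"
  obtain r B where r: "r > 0" "B \<ge> 0"
    "\<And>w F K. w \<in> S \<inter> ball z r \<Longrightarrow> F \<in> R \<Longrightarrow> K \<in> alg_tensor S \<Longrightarrow> norm (ev w F - K w) \<le> B * nrm (F - K)"
    using ev_bound[OF z] by metis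
  have "uniform_limit (S \<inter> ball z r) (\<lambda>k w. approx F k w $ i) (\<lambda>w. ev w F $ i) sequentially"
  proof (rule uniform_limitI)
    fix e :: real assume "e > 0"
    moreover have "(\<lambda>k. B * nrm (F - approx F k)) \<longlonglongrightarrow> 0"
      using tendsto_mult[OF tendsto_const approx_lim[OF F], of B] by simp
    ultimately have "\<forall>\<^sub>F k in sequentially. B * nrm (F - approx F k) < e"
      by (intro order_tendstoD(2)) auto
    then show "\<forall>\<^sub>F k in sequentially. \<forall>w\<in>S \<inter> ball z r. dist (approx F k w $ i) (ev w F $ i) < e"
    proof (rule eventually_mono, intro ballI)
      fix k w assume k: "B * nrm (F - approx F k) < e" and w: "w \<in> S \<inter> ball z r"
      have "dist (approx F k w $ i) (ev w F $ i) \<le> dist (approx F k w) (ev w F)" by (rule dist_vec_nth_le)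
      also have "\<dots> \<le> B * nrm (F - approx F k)"
        using r(3)[OF w F approx(1)[OF F]] by (simp add: dist_norm norm_minus_commute)
      finally show "dist (approx F k w $ i) (ev w F $ i) < e" using k by simp
    qed
  qed
  then show "\<exists>r>0. uniform_limit (S \<inter> ball z r) (\<lambda>k w. approx F k w $ i) (\<lambda>w. ev w F $ i) sequentially"
    using r(1) by blast
qed

text \<open>Condition (3) enters here: the approximants of \<open>F\<close> form a Cauchy sequence
  with pointwise limit 0, hence tend to 0 in norm, and so \<open>F\<close> is 0.\<close>

lemma ev_total:
  assumes F: "F \<in> R" and 0: "\<And>z. z \<in> S \<Longrightarrow> ev z F = 0"
  shows "F = 0"
proof -
  have X: "approx F k \<in> R" for k using approx(1) F alg_in by auto
  have "rcauchy ip (approx F)"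
    unfolding rcauchy_def rnorm_diff_eq
  proof (intro allI impI)
    fix e :: real assume e: "e > 0"
    then have "\<forall>\<^sub>F k in sequentially. nrm (F - approx F k) < e / 2"
      using order_tendstoD(2)[OF approx_lim[OF F], of "e / 2"] by simp
    then obtain N where N: "\<And>k. k \<ge> N \<Longrightarrow> nrm (F - approx F k) < e / 2"
      unfolding eventually_sequentially by blast
    have "nrm (approx F k - approx F l) < e" if "k \<ge> N" "l \<ge> N" for k l
      using nrm_triangle_diff[OF X[of k] F X[of l]] nrm_minus_commute[OF F X[of k]] N[OF that(1)] N[OF that(2)]
      by linarith
    then show "\<exists>N. \<forall>k\<ge>N. \<forall>l\<ge>N. nrm (approx F k - approx F l) < e" by blast
  qed
  moreover have "(\<lambda>k. approx F k z) \<longlonglongrightarrow> 0" if "z \<in> S" for z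
    using ev_lim[OF that F approx(1)[OF F] approx_lim[OF F]] 0[OF that] by simp
  ultimately have "(\<lambda>k. nrm (approx F k)) \<longlonglongrightarrow> 0"
    using alg_tensor_null[of "approx F"] approx(1)[OF F] by (simp add: rnorm_eq)
  from tendsto_add[OF this approx_lim[OF F]]
  have "(\<lambda>k. nrm (approx F k) + nrm (F - approx F k)) \<longlonglongrightarrow> 0" by simp
  then have "nrm F \<le> 0"
    by (rule LIMSEQ_le_const) (use nrm_diff_le[OF F X] in blast)
  then show ?thesis using nrm_eq_0[OF F] nrm_ge_0[OF F] by simp
qed

lemma ev_surj: "z \<in> S \<Longrightarrow> \<exists>F\<in>R. ev z F = v"
  using ev_alg[OF _ alg_tensor_const, of z v] alg_in[OF alg_tensor_const[of S v]] by auto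

end

section \<open>Coordinates in the localizations\<close>

lemma comb_eq_sum: "comb f c = (\<Sum>i\<in>UNIV. fsc (c $ i) (f i))"
proof -
  have "(\<Sum>i\<in>I. fsc (c $ i) (f i)) = (\<lambda>w. \<Sum>i\<in>I. c $ i *s f i w)" for I
    by (induction I rule: infinite_finite_induct) (simp_all add: fsc_def zero_fun_def plus_fun_def)
  then show ?thesis by (simp add: comb_def)
qed

locale generated_module = quasi_free_module S R ip
  for S :: "(complex^'n::finite) set" and R :: "(complex^'n \<Rightarrow> complex^'m::finite) set" and ip +
  fixes f :: "'m \<Rightarrow> complex^'n \<Rightarrow> complex^'m"
  assumes gen: "gen_set S R ip f"
begin

lemma f_in: "f i \<in> R"
  using gen by (simp add: gen_set_def)

lemma comb_in: "comb f c \<in> R"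
  unfolding comb_eq_sum by (intro sum_in scale_in f_in)

lemma comb_mod: "z \<in> S \<Longrightarrow> F \<in> R \<Longrightarrow> \<exists>c. F - comb f c \<in> Rsub S R ip z"
  using gen unfolding gen_set_def fun_diff_def by blast

definition A_sub :: "complex^'n \<Rightarrow> (complex^'n \<Rightarrow> complex^'m) set" where
  "A_sub z = cspan {G. \<exists>\<phi> F. \<phi> \<in> A_alg S \<and> \<phi> z = 0 \<and> F \<in> R \<and> G = (\<lambda>w. \<phi> w *s F w)}"

lemma Rsub_eq_hclosure: "Rsub S R ip z = hclosure (A_sub z)"
  by (simp add: Rsub_def rclosure_def hclosure_def A_sub_def rnorm_diff_eq)

lemma ev_zero: "z \<in> S \<Longrightarrow> ev z 0 = 0"
  using ev_alg[OF _ alg_zero] by simp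

lemma ev_diff: "z \<in> S \<Longrightarrow> F \<in> R \<Longrightarrow> G \<in> R \<Longrightarrow> ev z (F - G) = ev z F - ev z G"
  using ev_add[of z F "fsc (-1) G"] ev_scale[of z G "-1"] scale_in[of G "-1"] by simp

text \<open>Evaluation kills every product \<phi> F with \<phi> z = 0, and its boundedness extends
  this to the closure of their span.\<close>

lemma ev_Rsub:
  assumes z: "z \<in> S" and F: "F \<in> Rsub S R ip z"
  shows "ev z F = 0"
proof -
  have "A_sub z \<subseteq> {F \<in> R. ev z F = 0}"
    unfolding A_sub_def
    by (rule cspan_minimal) (auto simp: ev_mult ev_zero ev_add ev_scale z intro: R_mult carrier_intros)
  then have sub: "G \<in> R" "ev z G = 0" if "G \<in> A_sub z" for G using that by auto
  have FR: "F \<in> R" using F by (simp add: Rsub_eq_hclosure hclosure_def)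
  obtain r B where r: "r > 0" "B \<ge> 0" "\<And>w F. w \<in> S \<inter> ball z r \<Longrightarrow> F \<in> R \<Longrightarrow> norm (ev w F) \<le> B * nrm F"
    using ev_norm_le[OF z] by metis
  have "norm (ev z F) \<le> e" if e: "e > 0" for e
  proof -
    have "e / (B + 1) > 0" using e r(2) by simp
    then obtain G where G: "G \<in> A_sub z" "nrm (F - G) < e / (B + 1)"
      using F unfolding Rsub_eq_hclosure hclosure_def by blast
    have "norm (ev z F) = norm (ev z (F - G))" using ev_diff[OF z FR sub(1)[OF G(1)]] sub(2)[OF G(1)] by simp
    also have "\<dots> \<le> B * nrm (F - G)" using r z FR sub(1)[OF G(1)] by (simp add: diff_in)
    also have "\<dots> \<le> (B + 1) * (e / (B + 1))"
      using G(2) r(2) FR sub(1)[OF G(1)] by (intro mult_mono) (auto simp: diff_in)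
    also have "\<dots> = e" using r(2) by simp
    finally show ?thesis .
  qed
  then have "norm (ev z F) \<le> 0" by (rule field_le_epsilon) simp
  then show ?thesis by simp
qed

text \<open>Column j is the value of generator j at \<open>z\<close>, so the matrix passes from
  coordinates in the localization to values.\<close>

definition frame :: "complex^'n \<Rightarrow> complex^'m^'m" where
  "frame z = (\<chi> i j. ev z (f j) $ i)"

lemma ev_comb:
  assumes z: "z \<in> S"
  shows "ev z (comb f c) = frame z *v c"
proof -
  have "ev z (comb f c) = (\<Sum>i\<in>UNIV. ev z (fsc (c $ i) (f i)))"
    unfolding comb_eq_sum using z by (intro additive_sum ev_zero ev_add scale_in f_in)
  also have "\<dots> = (\<Sum>i\<in>UNIV. c $ i *s ev z (f i))" by (simp add: ev_scale z f_in)
  also have "\<dots> = frame z *v c"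
    by (simp add: vec_eq_iff frame_def matrix_vector_mult_def mult.commute)
  finally show ?thesis .
qed

lemma ev_eq_frame:
  assumes z: "z \<in> S" and F: "F \<in> R"
  shows "\<exists>c. F - comb f c \<in> Rsub S R ip z \<and> ev z F = frame z *v c"
proof -
  obtain c where c: "F - comb f c \<in> Rsub S R ip z" using comb_mod[OF z F] by blast
  then have "ev z F - ev z (comb f c) = 0"
    using ev_Rsub[OF z c] ev_diff[OF z F comb_in] by simp
  then show ?thesis using c ev_comb[OF z] by auto
qed

text \<open>Every vector is a value at \<open>z\<close>, and modulo \<open>Rsub\<close>, which
  evaluation kills, every element is a combination of generators. So this square matrix is
  onto.\<close>

lemma frame_invertible: "z \<in> S \<Longrightarrow> invertible (frame z)"
proof -
  assume z: "z \<in> S"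
  have "surj ((*v) (frame z))"
  proof (unfold surj_def, rule allI)
    fix v
    obtain F where F: "F \<in> R" "ev z F = v" using ev_surj[OF z] by blast
    then show "\<exists>c. v = frame z *v c" using ev_eq_frame[OF z F(1)] by auto
  qed
  then have "\<exists>B. frame z ** B = mat 1" by (simp add: matrix_right_invertible_surjective)
  then show ?thesis by (simp add: invertible_right_inverse)
qed

text \<open>Coordinates in the localization at \<open>z\<close> with respect to the basis of the generators.\<close>

definition crd :: "complex^'n \<Rightarrow> (complex^'n \<Rightarrow> complex^'m) \<Rightarrow> complex^'m" where
  "crd z F = matrix_inv (frame z) *v ev z F"

lemma frame_crd: "z \<in> S \<Longrightarrow> frame z *v crd z F = ev z F"
  by (simp add: crd_def matrix_inv_mult_vector(1) frame_invertible)

lemma crd_comb: "z \<in> S \<Longrightarrow> crd z (comb f c) = c"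
  by (simp add: crd_def ev_comb matrix_inv_mult_vector(2) frame_invertible)

lemma frame_lhol: "lhol S (\<lambda>z. frame z $ i $ j)"
  by (simp add: frame_def ev_lhol f_in)

text \<open>The columns of the inverse solve linear systems with constant right-hand sides, so
  \<open>lhol_solve\<close> applies.\<close>

lemma frame_inv_lhol: "lhol S (\<lambda>z. matrix_inv (frame z) $ i $ j)"
proof -
  have "lhol S (\<lambda>z. (matrix_inv (frame z) *v axis j 1) $ i)"
    by (rule lhol_solve[of S frame "\<lambda>z. axis j 1"])
      (auto simp: frame_lhol lhol_const frame_invertible matrix_inv_mult_vector(1))
  moreover have "(matrix_inv (frame z) *v axis j 1) $ i = matrix_inv (frame z) $ i $ j" for z
    by (simp add: matrix_vector_mult_def axis_def if_distrib cong: if_cong)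
  ultimately show ?thesis by simp
qed

lemma crd_bound:
  assumes z: "z \<in> S"
  shows "\<exists>r>0. \<exists>B. \<forall>w\<in>S \<inter> ball z r. \<forall>F\<in>R. norm (crd w F) \<le> B * nrm F"
proof -
  obtain r1 B where 1: "r1 > 0" "B \<ge> 0" "\<And>w F. w \<in> S \<inter> ball z r1 \<Longrightarrow> F \<in> R \<Longrightarrow> norm (ev w F) \<le> B * nrm F"
    using ev_norm_le[OF z] by metis
  obtain r2 K where 2: "r2 > 0" "K \<ge> 0"
    "\<And>w x. w \<in> S \<inter> ball z r2 \<Longrightarrow> norm (matrix_inv (frame w) *v x) \<le> K * norm x"
    using lhol_matrix_locally_bounded[of S "\<lambda>z. matrix_inv (frame z)" z, OF frame_inv_lhol z] by metis
  have "norm (crd w F) \<le> (K * B) * nrm F" if w: "w \<in> S \<inter> ball z (min r1 r2)" and F: "F \<in> R" for w F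
  proof -
    have "norm (crd w F) \<le> K * norm (ev w F)" unfolding crd_def using w by (intro 2(3)) auto
    also have "\<dots> \<le> K * (B * nrm F)" using w F 2(2) by (intro mult_left_mono 1(3)) auto
    finally show ?thesis by simp
  qed
  moreover have "min r1 r2 > 0" using 1(1) 2(1) by simp
  ultimately show ?thesis by blast
qed

sublocale rkhs fsc R ip S crd
proof unfold_locales
  show "crd z (F + G) = crd z F + crd z G" if "z \<in> S" "F \<in> R" "G \<in> R" for z F G
    using that by (simp add: crd_def ev_add matrix_vector_right_distrib)
  show "crd z (fsc c F) = c *s crd z F" if "z \<in> S" "F \<in> R" for z F c
    using that by (simp add: crd_def ev_scale vector_scalar_commute)
  show "lhol S (\<lambda>z. crd z F $ i)" if "F \<in> R" for F i
    by (rule lhol_solve[OF frame_lhol ev_lhol[OF that] frame_invertible frame_crd])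
  show "F = 0" if "F \<in> R" "\<And>z. z \<in> S \<Longrightarrow> crd z F = 0" for F
    using ev_total[OF that(1)] frame_crd[of _ F] that(2) by simp
qed (fact crd_bound)

lemma crd_mult:
  assumes "z \<in> S" "\<phi> \<in> A_alg S" "F \<in> R"
  shows "crd z (\<lambda>w. \<phi> w *s F w) = \<phi> z *s crd z F"
  using assms by (simp add: crd_def ev_mult vector_scalar_commute)

text \<open>Modulo \<open>Rsub\<close> an element is a combination of generators, whose coefficients
  are its coordinates; if these vanish, the element lies in \<open>Rsub\<close>. Thus
  \<open>crd z\<close> identifies the localization with coordinate space.\<close>

lemma Rsub_eq: "z \<in> S \<Longrightarrow> Rsub S R ip z = {F \<in> R. crd z F = 0}"
proof safe
  fix F assume z: "z \<in> S"
  show "F \<in> R" if "F \<in> Rsub S R ip z" using that by (simp add: Rsub_eq_hclosure hclosure_def)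
  show "crd z F = 0" if "F \<in> Rsub S R ip z" using ev_Rsub[OF z that] by (simp add: crd_def)
  show "F \<in> Rsub S R ip z" if F: "F \<in> R" "crd z F = 0"
  proof -
    obtain c where c: "F - comb f c \<in> Rsub S R ip z" using comb_mod[OF z F(1)] by blast
    then have "crd z (F - comb f c) = 0" using ev_Rsub[OF z] by (simp add: crd_def)
    then have "c = 0" using C_diff[OF z F(1) comb_in] F(2) crd_comb[OF z] by simp
    then have "comb f c = 0" by (simp add: comb_def zero_fun_def)
    then show ?thesis using c by simp
  qed
qed

lemma crd_surj: "z \<in> S \<Longrightarrow> \<exists>F\<in>R. crd z F = c"
  using crd_comb comb_in by blast

lemma gram_inv: "z \<in> S \<Longrightarrow> gram z *v (matrix_inv (gram z) *v x) = x"
  "z \<in> S \<Longrightarrow> matrix_inv (gram z) *v (gram z *v x) = x"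
  using matrix_inv_mult_vector[OF gram_invertible[OF _ crd_surj]] by blast+

text \<open>The component of \<open>F\<close> orthogonal to \<open>Rsub S R ip z\<close> is a kernel function, because kernel
  functions are orthogonal to everything with vanishing coordinates at \<open>z\<close>.\<close>

lemma orth_part_eq:
  assumes z: "z \<in> S" and F: "F \<in> R"
  shows "orth_part S R ip z F = krn z (matrix_inv (gram z) *v crd z F)"
  unfolding orth_part_def
proof (rule the_equality)
  let ?v = "matrix_inv (gram z) *v crd z F"
  have k: "krn z ?v \<in> R" using z by (rule krn_in)
  have sub: "G \<in> Rsub S R ip z \<longleftrightarrow> G \<in> R \<and> crd z G = 0" for G by (simp add: Rsub_eq[OF z])
  have kR: "F - krn z ?v \<in> Rsub S R ip z"
    using gram_mult[OF z, of ?v] by (simp add: sub diff_in C_diff z F k gram_inv)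
  have orth: "ip (krn z ?v) G = 0" if "G \<in> Rsub S R ip z" for G
    using that by (simp add: sub ip_krn_left[OF z])
  show "krn z ?v \<in> R \<and> (\<lambda>w. F w - krn z ?v w) \<in> Rsub S R ip z \<and> (\<forall>k\<in>Rsub S R ip z. ip (krn z ?v) k = 0)"
    using k kR orth by (simp add: fun_diff_def)
  fix h assume "h \<in> R \<and> (\<lambda>w. F w - h w) \<in> Rsub S R ip z \<and> (\<forall>k\<in>Rsub S R ip z. ip h k = 0)"
  then have h: "h \<in> R" "F - h \<in> Rsub S R ip z" "\<And>k. k \<in> Rsub S R ip z \<Longrightarrow> ip h k = 0"
    by (auto simp: fun_diff_def)
  have "crd z h = crd z F" using h(2) C_diff[OF z F h(1)] by (simp add: sub)
  moreover have "crd z (krn z ?v) = crd z F" using gram_mult[OF z, of ?v] by (simp add: gram_inv z)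
  ultimately have d: "h - krn z ?v \<in> Rsub S R ip z"
    using h(1) k by (simp add: sub diff_in C_diff z)
  then have "ip (h - krn z ?v) (h - krn z ?v) = 0"
    using h(3)[OF d] orth[OF d] h(1) k by (simp add: ip_diff_left diff_in)
  then show "h = krn z ?v" using ip_eq_0[of "h - krn z ?v"] h(1) k by (simp add: diff_in)
qed

lemma loc_ip_comb:
  assumes z: "z \<in> S"
  shows "loc_ip S R ip z (comb f c) (comb f d) = cip c (matrix_inv (gram z) *v d)"
  by (simp add: loc_ip_def orth_part_eq z comb_in crd_comb ip_krn_krn gram_inv)

end

section \<open>The modulus\<close>

text \<open>The two matrices in the hypothesis on the modulus are definite descriptions; this
  supplies the existence and uniqueness behind them. Nondegeneracy of the form given by
  \<open>B\<close> determines the solution.\<close>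

lemma sesquilinear_representation:
  fixes B T :: "complex^'m::finite^'m"
  assumes B: "invertible B"
  shows "\<exists>!M. \<forall>c d. cip (T *v c) d = cip (M *v c) (B *v d)"
proof (rule ex1I)
  show "\<forall>c d. cip (T *v c) d = cip ((adj (matrix_inv B) ** T) *v c) (B *v d)"
    by (simp add: matrix_vector_mul_assoc[symmetric] cip_adj matrix_inv_mult_vector(2)[OF B])
  fix M assume M: "\<forall>c d. cip (T *v c) d = cip (M *v c) (B *v d)"
  have "M *v c = (adj (matrix_inv B) ** T) *v c" for c
  proof (rule cip_eqI)
    fix u
    have "cip (M *v c) u = cip (M *v c) (B *v (matrix_inv B *v u))"
      by (simp only: matrix_inv_mult_vector(1)[OF B])
    also have "\<dots> = cip (T *v c) (matrix_inv B *v u)" using M by simp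
    also have "\<dots> = cip ((adj (matrix_inv B) ** T) *v c) u"
      by (simp add: matrix_vector_mul_assoc[symmetric] cip_adj)
    finally show "cip (M *v c) u = cip ((adj (matrix_inv B) ** T) *v c) u" .
  qed
  then show "M = adj (matrix_inv B) ** T" by (simp add: matrix_eq)
qed

context generated_module
begin

lemma gram_inv_invertible: "z \<in> S \<Longrightarrow> invertible (matrix_inv (gram z))"
proof -
  assume z: "z \<in> S"
  have "x = 0" if "matrix_inv (gram z) *v x = 0" for x
    using gram_inv(1)[OF z, of x] that by simp
  then show ?thesis unfolding invertible_left_inverse matrix_left_invertible_ker by blast
qed

lemma abs_sq_prop:
  assumes z: "z \<in> S"
  shows "cip (P z *v c) (matrix_inv (gram z) *v (P z *v d)) =
    cip (abs_sq S R ip f P z *v c) (matrix_inv (gram z) *v d)"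
proof -
  let ?B = "matrix_inv (gram z)"
  \<comment> \<open>All factors acting on \<open>d\<close> are moved to the first argument, which
    brings the form into the shape of \<open>sesquilinear_representation\<close>.\<close>
  let ?T = "adj (P z) ** (adj ?B ** P z)"
  have T: "cip (P z *v c) (?B *v (P z *v d)) = cip (?T *v c) d" for c d
    by (simp add: matrix_vector_mul_assoc[symmetric] cip_adj)
  have eq: "abs_sq S R ip f P z = (THE N. \<forall>c d. cip (?T *v c) d = cip (N *v c) (?B *v d))"
    unfolding abs_sq_def loc_ip_comb[OF z] T ..
  have "\<forall>c d. cip (?T *v c) d = cip (abs_sq S R ip f P z *v c) (?B *v d)"
    unfolding eq by (rule theI'[OF sesquilinear_representation[OF gram_inv_invertible[OF z]]])
  then show ?thesis unfolding T by blast
qed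

lemma modulus_sq_prop:
  assumes g: "generated_module S R' ip' g" and z: "z \<in> S"
  shows "loc_ip S R' ip' z (comb g c) (comb g d) =
    cip (modulus_sq S R ip R' ip' f g z *v c) (matrix_inv (gram z) *v d)"
proof -
  interpret G: generated_module S R' ip' g by fact
  let ?B = "matrix_inv (gram z)"
  let ?T = "adj (matrix_inv (G.gram z))"
  have T: "cip c (matrix_inv (G.gram z) *v d) = cip (?T *v c) d" for c d
    by (simp add: cip_adj)
  have eq: "modulus_sq S R ip R' ip' f g z = (THE N. \<forall>c d. cip (?T *v c) d = cip (N *v c) (?B *v d))"
    unfolding modulus_sq_def loc_ip_comb[OF z] G.loc_ip_comb[OF z] T ..
  have "\<forall>c d. cip (?T *v c) d = cip (modulus_sq S R ip R' ip' f g z *v c) (?B *v d)"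
    unfolding eq by (rule theI'[OF sesquilinear_representation[OF gram_inv_invertible[OF z]]])
  then show ?thesis unfolding G.loc_ip_comb[OF z] T by blast
qed

end

theorem theorem5:
  fixes S :: "(complex^'n::finite) set"
    and R R' :: "(complex^'n \<Rightarrow> complex^'m::finite) set"
    and ip ip' :: "(complex^'n \<Rightarrow> complex^'m) \<Rightarrow> (complex^'n \<Rightarrow> complex^'m) \<Rightarrow> complex"
    and f g :: "'m \<Rightarrow> complex^'n \<Rightarrow> complex^'m"
    and Psi :: "complex^'n \<Rightarrow> complex^'m^'m"
  assumes "bounded S" and "open S" and "connected S" and "starlike S"
    and "quasi_free S R ip" and "quasi_free S R' ip'"
    and "gen_set S R ip f" and "gen_set S R' ip' g"
    and "holo_mat S Psi"
    and "\<forall>z\<in>S. modulus_sq S R ip R' ip' f g z = abs_sq S R ip f Psi z"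
  shows "unit_equiv S R ip R' ip'"
proof -
  interpret A: generated_module S R ip f
    by unfold_locales (fact assms)+
  interpret B: generated_module S R' ip' g
    by unfold_locales (fact assms)+
  have B: "generated_module S R' ip' g" by unfold_locales
  let ?Ai = "\<lambda>z. matrix_inv (A.gram z)" and ?Bi = "\<lambda>z. matrix_inv (B.gram z)"
  have key: "?Bi z *v d = adj (Psi z) *v (?Ai z *v (Psi z *v d))" if z: "z \<in> S" for z d
  proof (rule cip_eqI_right)
    fix c
    have "cip c (?Bi z *v d) = cip (Psi z *v c) (?Ai z *v (Psi z *v d))"
      using A.modulus_sq_prop[OF B z, of c d] A.abs_sq_prop[OF z, of Psi c d] assms(10) z
      by (simp add: B.loc_ip_comb)
    then show "cip c (?Bi z *v d) = cip c (adj (Psi z) *v (?Ai z *v (Psi z *v d)))"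
      by (simp add: cip_adj)
  qed
  \<comment> \<open>The left side of \<open>key\<close> is injective in \<open>d\<close>, while its
    right side depends on \<open>d\<close> only through \<open>Psi z *v d\<close>.\<close>
  have Psi_inj: "d = 0" if "z \<in> S" "Psi z *v d = 0" for z d
    using key[OF that(1), of d] that B.gram_inv(1)[OF that(1), of d] by simp
  have Psi_surj: "\<exists>d. Psi z *v d = v" if z: "z \<in> S" for z v
  proof -
    have "invertible (Psi z)"
      unfolding invertible_left_inverse matrix_left_invertible_ker using Psi_inj[OF z] by blast
    then show ?thesis using matrix_inv_mult_vector(1) by blast
  qed
  have Psi_lhol: "lhol S (\<lambda>z. Psi z $ i $ j)" for i j
    using assms(9) by (simp add: holo_mat_def holo_on_imp_lhol)
  have gram_eq: "A.gram z *v v = Psi z *v (B.gram z *v (adj (Psi z) *v v))" if z: "z \<in> S" for z v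
  proof -
    \<comment> \<open>For this \<open>d\<close> the factor \<open>?Ai z\<close> in
      \<open>key\<close> cancels against \<open>A.gram z\<close>.\<close>
    obtain d where d: "Psi z *v d = A.gram z *v v" using Psi_surj[OF z] by blast
    have "?Bi z *v d = adj (Psi z) *v v" using key[OF z, of d] by (simp add: d A.gram_inv z)
    then have "B.gram z *v (adj (Psi z) *v v) = d" using B.gram_inv(1)[OF z, of d] by simp
    then show ?thesis using d by simp
  qed
  \<comment> \<open>Twisting the coordinates of \<open>R'\<close> by \<Psi> multiplies its kernel by
    \<Psi> on the left and by the adjoint on the right, so that \<open>gram_eq\<close> says that the
    kernels of \<open>A.crd\<close> and \<open>D\<close> agree on the diagonal. Totality survives
    because \<Psi> is injective at every point.\<close>
  define D where "D z F = Psi z *v B.crd z F" for z F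
  interpret D: rkhs fsc R' ip' S D
  proof unfold_locales
    show "D z (F + G) = D z F + D z G" if "z \<in> S" "F \<in> R'" "G \<in> R'" for z F G
      using that by (simp add: D_def B.C_add matrix_vector_right_distrib)
    show "D z (fsc c F) = c *s D z F" if "z \<in> S" "F \<in> R'" for z F c
      using that by (simp add: D_def B.C_scale vector_scalar_commute)
    show "lhol S (\<lambda>z. D z F $ i)" if "F \<in> R'" for F i
      using that by (auto simp: D_def matrix_vector_mult_def intro!: lhol_sum lhol_mult Psi_lhol B.C_lhol)
    show "F = 0" if "F \<in> R'" "\<And>z. z \<in> S \<Longrightarrow> D z F = 0" for F
    proof (rule B.C_total[OF that(1)])
      show "B.crd z F = 0" if "z \<in> S" for z
        using Psi_inj[OF \<open>z \<in> S\<close>, of "B.crd z F"] \<open>\<And>z. z \<in> S \<Longrightarrow> D z F = 0\<close>[OF \<open>z \<in> S\<close>]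
        by (simp add: D_def)
    qed
    show "\<exists>r>0. \<exists>K. \<forall>w\<in>S \<inter> ball z r. \<forall>F\<in>R'. norm (D w F) \<le> K * B.nrm F" if z: "z \<in> S" for z
    proof -
      obtain r1 K where 1: "r1 > 0" "K \<ge> 0" "\<And>w x. w \<in> S \<inter> ball z r1 \<Longrightarrow> norm (Psi w *v x) \<le> K * norm x"
        using lhol_matrix_locally_bounded[of S Psi z, OF Psi_lhol z] by metis
      obtain r2 C where 2: "r2 > 0" "\<And>w F. w \<in> S \<inter> ball z r2 \<Longrightarrow> F \<in> R' \<Longrightarrow> norm (B.crd w F) \<le> C * B.nrm F"
        using B.C_bound[OF z] by metis
      have "norm (D w F) \<le> (K * C) * B.nrm F" if w: "w \<in> S \<inter> ball z (min r1 r2)" and F: "F \<in> R'" for w F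
      proof -
        have "norm (D w F) \<le> K * norm (B.crd w F)" unfolding D_def using w by (intro 1(3)) auto
        also have "\<dots> \<le> K * (C * B.nrm F)" using w F 1(2) by (intro mult_left_mono 2(2)) auto
        finally show ?thesis by simp
      qed
      moreover have "min r1 r2 > 0" using 1(1) 2(1) by simp
      ultimately show ?thesis by blast
    qed
  qed
  have D_krn: "D.krn z v = B.krn z (adj (Psi z) *v v)" if z: "z \<in> S" for z v
    using z by (intro D.krn_unique[symmetric]) (simp_all add: B.krn_in B.ip_krn D_def cip_adj)
  interpret P: rkhs_pair fsc R ip fsc R' ip' S A.crd D
  proof unfold_locales
    show "ip (A.krn z v) (A.krn z u) = ip' (D.krn z v) (D.krn z u)" if z: "z \<in> S" for z v u
      by (simp add: D_krn z A.ip_krn_krn B.ip_krn_krn gram_eq cip_adj)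
  qed (fact assms)+
  obtain U where U: "bij_betw U R R'" "\<And>F z. F \<in> R \<Longrightarrow> z \<in> S \<Longrightarrow> D z (U F) = A.crd z F"
    "\<And>F G. F \<in> R \<Longrightarrow> G \<in> R \<Longrightarrow> ip' (U F) (U G) = ip F G"
    using P.unitary_exists by blast
  have UR: "U F \<in> R'" if "F \<in> R" for F using bij_betwE[OF U(1)] that by blast
  \<comment> \<open>Elements of \<open>R'\<close> coincide once every \<open>D z\<close> agrees on
    them, and \<open>D z\<close> after \<open>U\<close> is \<open>A.crd z\<close>; so linearity and
    the module property of \<open>U\<close> are inherited from the evaluations.\<close>
  have "U (F + G) = U F + U G" if "F \<in> R" "G \<in> R" for F G
    using that by (intro D.C_eqI) (simp_all add: UR U(2) A.R_add B.R_add A.C_add D.C_add)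
  moreover have "U (fsc c F) = fsc c (U F)" if "F \<in> R" for F c
    using that by (intro D.C_eqI) (simp_all add: UR U(2) A.R_scale B.R_scale A.C_scale D.C_scale)
  moreover have "U (\<lambda>w. \<phi> w *s F w) = (\<lambda>w. \<phi> w *s U F w)" if "\<phi> \<in> A_alg S" "F \<in> R" for \<phi> F
  proof (rule D.C_eqI)
    show "D z (U (\<lambda>w. \<phi> w *s F w)) = D z (\<lambda>w. \<phi> w *s U F w)" if z: "z \<in> S" for z
    proof -
      have "D z (\<lambda>w. \<phi> w *s U F w) = \<phi> z *s D z (U F)"
        using \<open>\<phi> \<in> A_alg S\<close> \<open>F \<in> R\<close> z by (simp add: D_def B.crd_mult UR vector_scalar_commute)
      then show ?thesis
        using \<open>\<phi> \<in> A_alg S\<close> \<open>F \<in> R\<close> z by (simp add: U(2) A.R_mult A.crd_mult)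
    qed
  qed (use that in \<open>auto intro: UR A.R_mult B.R_mult\<close>)
  ultimately show ?thesis
    unfolding unit_equiv_def using U(1,3) by (intro exI[of _ U]) (simp add: plus_fun_def fsc_def)
qed

end
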